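(* Let $n\ge0$ be an integer. (a) If $n$ is even (resp. odd), there exists a magic-faced folded hypercube (resp. magic-faced hierarchical folded hypercube) $A_n$ of dimension $n$, which is unique up to the action of $\mathrm{Aut}(FQ_n)$ (resp. $\mathrm{Aut}(HFQ_n)$), i.e. up to automorphisms of the underlying graph. (b) Magic-faced hypercubes of dimension $n$ are in one-to-one correspondence with graph embeddings $\phi:Q_n\hookrightarrow FQ_n$ if $n$ is even, and with graph embeddings $\phi:Q_n\hookrightarrow HFQ_n$ if $n$ is odd. Given such an embedding $\phi$, the corresponding magic-faced hypercube is the one in which the label of a vertex $v\in Q_n$ is $A_n(\phi(v))$.
   Context: $Q_n$ is the hypercube graph on vertex set $\{0,1\}^n$ (two vertices adjacent iff they differ in exactly one coordinate). A magic-faced hypercube of dimension $n$ is a bijective labeling of the vertices of $Q_n$ by $1,\ldots,2^n$ such that every $4$-cycle of $Q_n$ (equivalently, every $2\times2$ face of the $2\times\cdots\times2$ array) has the same sum of labels. The folded hypercube graph $FQ_n$ is $Q_n$ together with an additional edge joining each pair of antipodal vertices (vertices differing in all $n$ coordinates); $FQ_0$ is a single vertex. For $n\ge1$, the hierarchical folded hypercube graph is $HFQ_n:=K_2\times FQ_{n-1}$ (Cartesian product of graphs). A magic-faced folded hypercube (resp. magic-faced hierarchical folded hypercube) of dimension $n$ is a bijective labeling of the vertices of $FQ_n$ (resp. $HFQ_n$) by the integers $1,\ldots,2^n$ such that the labels on every $4$-cycle of $FQ_n$ (resp. $HFQ_n$) have the same sum. Graph automorphisms act on labelings by permuting vertices.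 A graph embedding is an injective map on vertices sending edges to edges (not necessarily induced). *)

theory Defs
  imports "HOL-Library.FuncSet"
begin

record 'a sgraph =
  verts :: "'a set"
  adj :: "'a \<Rightarrow> 'a \<Rightarrow> bool"

definition simple_graph :: "'a sgraph \<Rightarrow> bool" where
  "simple_graph G \<longleftrightarrow>
     (\<forall>u v. adj G u v \<longrightarrow> u \<in> verts G \<and> v \<in> verts G \<and> u \<noteq> v \<and> adj G v u)"

definition K2 :: "bool sgraph" where
  "K2 = \<lparr>verts = UNIV, adj = (\<lambda>u v. u \<noteq> v)\<rparr>"

definition cartesian_product :: "'a sgraph \<Rightarrow> 'b sgraph \<Rightarrow> ('a \<times> 'b) sgraph" where
  "cartesian_product G H =
     \<lparr>verts = verts G \<times> verts H,
      adj = (\<lambda>(a, x) (b, y). (a = b \<and> a \<in> verts G \<and> adj H x y) \<or>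
                             (adj G a b \<and> x = y \<and> x \<in> verts H))\<rparr>"

definition cube_verts :: "nat \<Rightarrow> bool list set" where
  "cube_verts n = {u. length u = n}"

definition diff_coords :: "bool list \<Rightarrow> bool list \<Rightarrow> nat set" where
  "diff_coords u v = {i. i < length u \<and> u ! i \<noteq> v ! i}"

definition hypercube :: "nat \<Rightarrow> bool list sgraph" where
  "hypercube n =
     \<lparr>verts = cube_verts n,
      adj = (\<lambda>u v. u \<in> cube_verts n \<and> v \<in> cube_verts n \<and> card (diff_coords u v) = 1)\<rparr>"

(* The condition u \<noteq> v only matters for n = 0, where the unique vertex
   differs from itself in all 0 coordinates: it keeps FQ_0 free of a loop. *)
definition folded_hypercube :: "nat \<Rightarrow> bool list sgraph" where
  "folded_hypercube n =
     \<lparr>verts = cube_verts n,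
      adj = (\<lambda>u v. adj (hypercube n) u v \<or>
                   (u \<in> cube_verts n \<and> v \<in> cube_verts n \<and> u \<noteq> v \<and>
                    diff_coords u v = {..<n}))\<rparr>"

(* Only meaningful for n \<ge> 1, because of the truncated subtraction. *)
definition hier_folded_hypercube :: "nat \<Rightarrow> (bool \<times> bool list) sgraph" where
  "hier_folded_hypercube n = cartesian_product K2 (folded_hypercube (n - 1))"

definition four_cycle :: "'a sgraph \<Rightarrow> 'a \<Rightarrow> 'a \<Rightarrow> 'a \<Rightarrow> 'a \<Rightarrow> bool" where
  "four_cycle G a b c d \<longleftrightarrow>
     distinct [a, b, c, d] \<and> adj G a b \<and> adj G b c \<and> adj G c d \<and> adj G d a"

(* Labelings and embeddings are made extensional (value undefined outside the vertex
   set), so that equality of functions is equality on the vertex set. *)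
definition magic_faced :: "nat \<Rightarrow> 'a sgraph \<Rightarrow> ('a \<Rightarrow> nat) set" where
  "magic_faced n G =
     {A \<in> extensional (verts G). bij_betw A (verts G) {1..2 ^ n} \<and>
        (\<exists>s. \<forall>a b c d. four_cycle G a b c d \<longrightarrow> A a + A b + A c + A d = s)}"

definition automorphisms :: "'a sgraph \<Rightarrow> ('a \<Rightarrow> 'a) set" where
  "automorphisms G =
     {\<sigma> \<in> extensional (verts G). bij_betw \<sigma> (verts G) (verts G) \<and>
        (\<forall>u \<in> verts G. \<forall>v \<in> verts G. adj G (\<sigma> u) (\<sigma> v) \<longleftrightarrow> adj G u v)}"

definition embeddings :: "'a sgraph \<Rightarrow> 'b sgraph \<Rightarrow> ('a \<Rightarrow> 'b) set" where
  "embeddings G H =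
     {\<phi> \<in> verts G \<rightarrow>\<^sub>E verts H. inj_on \<phi> (verts G) \<and>
        (\<forall>u v. adj G u v \<longrightarrow> adj H (\<phi> u) (\<phi> v))}"

lemma simple_graph_hypercube: "simple_graph (hypercube n)"
proof -
  have "diff_coords u v = diff_coords v u" if "length u = length v" for u v
    using that by (auto simp: diff_coords_def)
  moreover have "diff_coords u u = {}" for u
    by (auto simp: diff_coords_def)
  ultimately show ?thesis
    by (auto simp: simple_graph_def hypercube_def cube_verts_def)
qed

lemma simple_graph_folded_hypercube: "simple_graph (folded_hypercube n)"
proof -
  have "diff_coords u v = diff_coords v u" if "length u = length v" for u v
    using that by (auto simp: diff_coords_def)
  with simple_graph_hypercube[of n] show ?thesis
    by (auto simp: simple_graph_def folded_hypercube_def hypercube_def cube_verts_def)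
qed

lemma simple_graph_cartesian_product:
  "simple_graph G \<Longrightarrow> simple_graph H \<Longrightarrow> simple_graph (cartesian_product G H)"
  by (auto simp: simple_graph_def cartesian_product_def)

lemma simple_graph_hier_folded_hypercube: "simple_graph (hier_folded_hypercube n)"
  unfolding hier_folded_hypercube_def
  by (intro simple_graph_cartesian_product simple_graph_folded_hypercube)
     (simp add: simple_graph_def K2_def)

end

theory Submission
  imports Defs Complex_Main
begin

text \<open>
  Call two labels adjacent if the binary expansions of their predecessors agree in at most one
  place. In this label graph a vertex, its neighbour and a further neighbour of that one never
  share a bit, so exactly two of the four labels on a 4-cycle have a given bit set: all 4-cycles
  have the same sum.

  Conversely, let \<open>A\<close> be a magic-faced hypercube, centre its labels to \<open>f = 2 A - (2 ^ n + 1)\<close>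
  and multiply by the parity character \<open>\<chi>\<close>. The face condition says that the mixed second
  differences of \<open>\<chi> f\<close> vanish, so \<open>f = \<chi> (c0 + c1 s1 + \<dots> + cn sn)\<close> with signs \<open>si\<close>. The values of
  \<open>f\<close> are symmetric about 0, so \<open>exp f\<close> and \<open>exp (- f)\<close> have the same sum; both sums factorise, and
  the difference is a product that vanishes only if some coefficient is 0. The remaining \<open>n\<close>
  coefficients have all odd numbers of absolute value below \<open>2 ^ n\<close> as signed sums, which forces
  their absolute values to be \<open>1, 2, 4, \<dots>, 2 ^ (n - 1)\<close>. Flipping one coordinate flips \<open>\<chi>\<close> and one
  \<open>si\<close>, hence all signed terms but one, that is, all bits of the label but at most one. So the
  magic-faced hypercubes are exactly the embeddings of \<open>Q_n\<close> into the label graph.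

  Finally, the label graph is isomorphic to \<open>FQ_n\<close> or \<open>HFQ_n\<close>, depending on the parity of \<open>n\<close>, and
  every edge of these graphs lies in an embedded copy of \<open>Q_n\<close>. Therefore a magic-faced labelling
  of either graph maps edges to edges of the label graph, and by counting edges it is an
  isomorphism.
\<close>

subsection \<open>Coordinate flips and characters of the cube\<close>

definition flip :: "nat \<Rightarrow> bool list \<Rightarrow> bool list" where
  "flip i w = w[i := \<not> w ! i]"

lemma length_flip [simp]: "length (flip i w) = length w"
  by (simp add: flip_def)

lemma nth_flip: "j < length w \<Longrightarrow> flip i w ! j = (if i = j then \<not> w ! j else w ! j)"
  by (simp add: flip_def nth_list_update)

lemma flip_Cons [simp]: "flip 0 (b # w) = (\<not> b) # w" "flip (Suc i) (b # w) = b # flip i w"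
  by (simp_all add: flip_def)

lemma flip_flip [simp]: "flip i (flip i w) = w"
  by (cases "i < length w") (simp_all add: flip_def list_update_beyond)

lemma mem_cube_verts: "w \<in> cube_verts n \<longleftrightarrow> length w = n"
  by (simp add: cube_verts_def)

lemma card_cube_verts: "card (cube_verts n) = 2 ^ n"
  and finite_cube_verts [simp]: "finite (cube_verts n)"
  using card_lists_length_eq[of "UNIV :: bool set" n] finite_lists_length_eq[of "UNIV :: bool set" n]
  by (simp_all add: cube_verts_def)

lemma verts_hypercube [simp]: "verts (hypercube n) = cube_verts n"
  by (simp add: hypercube_def)

lemma adj_hypercube_iff:
  "adj (hypercube n) u v \<longleftrightarrow> length u = n \<and> (\<exists>i<n. v = flip i u)"
proof safe
  assume uv: "adj (hypercube n) u v"
  then have len: "length u = n" "length v = n" and "card (diff_coords u v) = 1"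
    by (auto simp: hypercube_def mem_cube_verts)
  then obtain i where i: "diff_coords u v = {i}"
    by (auto simp: card_1_singleton_iff)
  have "i \<in> diff_coords u v" by (simp add: i)
  then have "i < n" using len by (simp add: diff_coords_def)
  moreover have "v = flip i u"
  proof (rule nth_equalityI)
    fix j assume j: "j < length v"
    then have "j \<in> diff_coords u v \<longleftrightarrow> u ! j \<noteq> v ! j"
      using len by (simp add: diff_coords_def)
    with j len i show "v ! j = flip i u ! j" by (auto simp: nth_flip)
  qed (simp add: len)
  ultimately show "\<exists>i<n. v = flip i u" by blast
  show "length u = n" by fact
next
  fix i assume "n = length u" "i < length u"
  then have "diff_coords u (flip i u) = {i}"
    by (auto simp: diff_coords_def nth_flip split: if_splits)
  then show "adj (hypercube (length u)) u (flip i u)"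
    by (simp add: hypercube_def mem_cube_verts)
qed

section \<open>Signs and exponential sums over the cube\<close>

definition sgn_of :: "bool \<Rightarrow> real" where
  "sgn_of b = (if b then - 1 else 1)"

definition chi :: "bool list \<Rightarrow> real" where
  "chi w = (\<Prod>i<length w. sgn_of (w ! i))"

lemma sgn_of_Not [simp]: "sgn_of (\<not> b) = - sgn_of b"
  by (simp add: sgn_of_def)

lemma sgn_of_cases: "sgn_of b = 1 \<or> sgn_of b = - 1"
  by (simp add: sgn_of_def)

lemma chi_cases: "chi w = 1 \<or> chi w = - 1"
proof -
  have "\<bar>chi w\<bar> = 1"
    unfolding chi_def abs_prod by (rule prod.neutral) (simp add: sgn_of_def)
  then show ?thesis by linarith
qed

lemma chi_square [simp]: "chi w * chi w = 1"
  using chi_cases[of w] by auto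

lemma chi_flip: "i < length w \<Longrightarrow> chi (flip i w) = - chi w"
  by (simp add: chi_def nth_flip prod.remove[of _ i])

lemma sum_cube_verts_Suc:
  fixes g :: "bool list \<Rightarrow> 'a :: comm_monoid_add"
  shows "sum g (cube_verts (Suc n)) = (\<Sum>w\<in>cube_verts n. g (False # w) + g (True # w))"
proof -
  have "cube_verts (Suc n) = Cons False ` cube_verts n \<union> Cons True ` cube_verts n"
    by (auto simp: cube_verts_def length_Suc_conv)
  then have "sum g (cube_verts (Suc n)) =
      sum g (Cons False ` cube_verts n) + sum g (Cons True ` cube_verts n)"
    by (simp only:) (rule sum.union_disjoint, auto)
  then show ?thesis
    by (simp add: sum.reindex inj_on_def sum.distrib)
qed

text \<open>Distributivity: expanding a product of \<open>n\<close> binomials selects one term from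
  each factor, and the selections are the vertices \<open>w\<close>.\<close>

lemma sum_cube_verts_prod:
  fixes g :: "nat \<Rightarrow> bool \<Rightarrow> 'a :: comm_semiring_1"
  shows "(\<Sum>w\<in>cube_verts n. \<Prod>i<n. g i (w ! i)) = (\<Prod>i<n. g i False + g i True)"
proof (induction n arbitrary: g)
  case 0
  show ?case by (simp add: cube_verts_def)
next
  case (Suc n)
  have "(\<Sum>w\<in>cube_verts (Suc n). \<Prod>i<Suc n. g i (w ! i)) =
      (\<Sum>w\<in>cube_verts n. (g 0 False + g 0 True) * (\<Prod>i<n. g (Suc i) (w ! i)))"
    unfolding sum_cube_verts_Suc prod.lessThan_Suc_shift by (simp add: algebra_simps)
  also have "\<dots> = (g 0 False + g 0 True) * (\<Prod>i<n. g (Suc i) False + g (Suc i) True)"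
    by (simp add: sum_distrib_left[symmetric] Suc.IH[of "\<lambda>i. g (Suc i)"])
  finally show ?case by (simp only: prod.lessThan_Suc_shift)
qed

text \<open>The character contributes one sign per coordinate, so each factor is a difference of
  exponentials instead of a sum. Hence the total vanishes exactly when some \<open>c i\<close> is 0,
  which is what \<open>f_eq_signed_sum\<close> exploits.\<close>

lemma sum_chi_exp:
  "(\<Sum>w\<in>cube_verts n. chi w * exp (c0 + (\<Sum>i<n. c i * sgn_of (w ! i)))) =
     exp c0 * (\<Prod>i<n. exp (c i) - exp (- c i))"
proof -
  have "chi w * exp (c0 + (\<Sum>i<n. c i * sgn_of (w ! i))) =
      exp c0 * (\<Prod>i<n. sgn_of (w ! i) * exp (c i * sgn_of (w ! i)))"
    if "w \<in> cube_verts n" for w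
    using that by (simp add: mem_cube_verts chi_def exp_add exp_sum prod.distrib)
  then have "(\<Sum>w\<in>cube_verts n. chi w * exp (c0 + (\<Sum>i<n. c i * sgn_of (w ! i)))) =
      exp c0 * (\<Sum>w\<in>cube_verts n. \<Prod>i<n. sgn_of (w ! i) * exp (c i * sgn_of (w ! i)))"
    by (simp add: sum_distrib_left)
  also have "\<dots> = exp c0 * (\<Prod>i<n. exp (c i) - exp (- c i))"
    unfolding sum_cube_verts_prod[of "\<lambda>i b. sgn_of b * exp (c i * sgn_of b)"]
    by (simp add: sgn_of_def)
  finally show ?thesis .
qed

section \<open>Functions with vanishing mixed second differences\<close>

lemma flip_invariant_const:
  assumes "\<And>w i. length w = n \<Longrightarrow> i < n \<Longrightarrow> g (flip i w) = g w"
    and "length u = n" "length v = n"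
  shows "g u = g v"
  using assms
proof (induction n arbitrary: g u v)
  case 0
  then show ?case by simp
next
  case (Suc n)
  obtain a u' b v' where uv: "u = a # u'" "v = b # v'" "length u' = n" "length v' = n"
    using Suc.prems(2,3) by (auto simp: length_Suc_conv)
  have inv: "g (a # flip i w) = g (a # w)" if "length w = n" "i < n" for w i
    using Suc.prems(1)[of "a # w" "Suc i"] that by simp
  have "g (a # u') = g (a # v')"
    using Suc.IH[of "\<lambda>w. g (a # w)" u' v'] inv uv(3,4) by blast
  also have "\<dots> = g (b # v')"
    using Suc.prems(1)[of "a # v'" 0] uv by (cases "a = b") auto
  finally show ?case using uv by simp
qed

text \<open>Induction on \<open>n\<close>: the hypothesis for direction 0 says that the difference
  \<open>D\<close> across it is invariant under all other flips, hence constant, and this constant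
  yields the coefficient of the new sign.\<close>

lemma affine_if_second_differences_zero:
  fixes h :: "bool list \<Rightarrow> real"
  assumes "\<And>w i j. length w = n \<Longrightarrow> i < j \<Longrightarrow> j < n \<Longrightarrow>
     h w + h (flip i (flip j w)) = h (flip i w) + h (flip j w)"
  shows "\<exists>c0 c. \<forall>w. length w = n \<longrightarrow> h w = c0 + (\<Sum>i<n. c i * sgn_of (w ! i))"
  using assms
proof (induction n arbitrary: h)
  case 0
  then show ?case by (intro exI[of _ "h []"]) auto
next
  case (Suc n)
  have "\<exists>c0 c. \<forall>w. length w = n \<longrightarrow> h (False # w) = c0 + (\<Sum>i<n. c i * sgn_of (w ! i))"
  proof (rule Suc.IH)
    fix w :: "bool list" and i j assume "length w = n" "i < j" "j < n"
    then show "h (False # w) + h (False # flip i (flip j w)) = h (False # flip i w) + h (False # flip j w)"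
      using Suc.prems[of "False # w" "Suc i" "Suc j"] by simp
  qed
  then obtain c0 c where
    c: "\<And>w. length w = n \<Longrightarrow> h (False # w) = c0 + (\<Sum>i<n. c i * sgn_of (w ! i))"
    by blast
  define D where "D w = h (True # w) - h (False # w)" for w
  have "D (flip i w) = D w" if "length w = n" "i < n" for i w
    using Suc.prems[of "False # w" 0 "Suc i"] that by (simp add: D_def)
  then have D: "D w = D (replicate n False)" if "length w = n" for w
    by (rule flip_invariant_const) (use that in auto)
  define d where "d = D (replicate n False)"
  \<comment> \<open>\<open>sgn_of\<close> is 1 at \<open>False\<close> and -1 at
    \<open>True\<close>, so a jump by \<open>d\<close> is a coefficient \<open>- d / 2\<close>
    together with a shift of the constant by \<open>d / 2\<close>.\<close>
  have "h w = (c0 + d / 2) + (\<Sum>i<Suc n. (case i of 0 \<Rightarrow> - d / 2 | Suc i \<Rightarrow> c i) * sgn_of (w ! i))"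
    if len: "length w = Suc n" for w
  proof -
    obtain b u where u: "w = b # u" "length u = n"
      using len by (auto simp: length_Suc_conv)
    have "h (b # u) = h (False # u) + (if b then d else 0)"
      using D[OF u(2)] by (simp add: D_def d_def)
    with c[OF u(2)] u(1) show ?thesis
      unfolding sum.lessThan_Suc_shift by (simp add: sgn_of_def)
  qed
  then show ?case by blast
qed

subsection \<open>Signed sums covering an interval\<close>

text \<open>There are as many choices of signs as values to be hit, so different subsets of
  \<open>I\<close> have different sums of absolute values, and these sums are 0, ...,
  \<open>2 ^ n - 1\<close>. The powers of 2 then emerge in increasing order, each as the least
  number that the earlier ones do not reach.\<close>

lemma signed_sums_imp_powers_of_2:
  fixes C :: "'a \<Rightarrow> real"
  assumes I: "finite I" "card I = n"
    and surj: "\<And>a. a < 2 ^ n \<Longrightarrow> \<exists>y. (\<forall>i\<in>I. y i = 1 \<or> y i = - 1) \<and>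
        2 * real a - (2 ^ n - 1) = (\<Sum>i\<in>I. C i * y i)"
  shows "\<exists>\<pi>. bij_betw \<pi> I {..<n} \<and> (\<forall>i\<in>I. \<bar>C i\<bar> = 2 ^ \<pi> i)"
proof -
  define S where "S T = (\<Sum>i\<in>T. \<bar>C i\<bar>)" for T
  have S_mono: "S T \<le> S T'" if "T \<subseteq> T'" "T' \<subseteq> I" for T T'
    unfolding S_def using that I by (intro sum_mono2) (auto intro: finite_subset)
  have rep: "\<exists>T\<in>Pow I. 2 * real a - (2 ^ n - 1) = S I - 2 * S T" if "a < 2 ^ n" for a
  proof -
    from surj[OF that] obtain y where y: "\<forall>i\<in>I. y i = 1 \<or> y i = - 1"
      "2 * real a - (2 ^ n - 1) = (\<Sum>i\<in>I. C i * y i)"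
      by blast
    \<comment> \<open>Collecting the negative terms absorbs the signs of \<open>C\<close> and turns
      a signed sum into \<open>S I - 2 * S T\<close>.\<close>
    define T where "T = {i \<in> I. C i * y i < 0}"
    have "(\<Sum>i\<in>I. C i * y i) = (\<Sum>i\<in>I. \<bar>C i\<bar> - 2 * (if i \<in> T then \<bar>C i\<bar> else 0))"
      using y(1) by (intro sum.cong refl) (force simp: T_def)
    also have "\<dots> = S I - 2 * (\<Sum>i\<in>I. if i \<in> T then \<bar>C i\<bar> else 0)"
      by (simp add: S_def sum_subtractf sum_distrib_left)
    also have "(\<Sum>i\<in>I. if i \<in> T then \<bar>C i\<bar> else 0) = S T"
      unfolding S_def using I by (subst sum.inter_restrict[symmetric]) (auto simp: T_def intro: sum.cong)
    finally show ?thesis using y(2) by (auto simp: T_def)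
  qed
  define V where "V = (\<lambda>a. 2 * real a - (2 ^ n - 1)) ` {..<2 ^ n}"
  define g where "g T = S I - 2 * S T" for T
  have cardV: "card V = 2 ^ n"
    unfolding V_def by (subst card_image) (auto simp: inj_on_def)
  have V_sub: "V \<subseteq> g ` Pow I"
    using rep by (auto simp: V_def g_def image_iff)
  have finP: "finite (Pow I)" and cardP: "card (Pow I) = 2 ^ n"
    using I by (auto simp: card_Pow)
  have "card (g ` Pow I) \<le> 2 ^ n"
    using card_image_le[OF finP, of g] cardP by simp
  then have V: "V = g ` Pow I"
    using V_sub finP cardV by (intro card_seteq) auto
  have inj_g: "inj_on g (Pow I)"
    using finP V cardV cardP by (intro eq_card_imp_inj_on) auto
  have inj_S: "T = T'" if "S T = S T'" "T \<subseteq> I" "T' \<subseteq> I" for T T'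
    using inj_g that by (auto simp: inj_on_def g_def)
  have "S {} = 0" by (simp add: S_def)
  \<comment> \<open>\<open>S I\<close> is the value of \<open>g\<close> at the empty set and thus
    its maximum, while the maximum of \<open>V\<close> is \<open>2 ^ n - 1\<close>.\<close>
  have SI: "S I = 2 ^ n - 1"
  proof (rule antisym)
    have "g {} \<in> V" using V by blast
    then obtain a :: nat where a: "a < 2 ^ n" "S I = 2 * real a - (2 ^ n - 1)"
      by (auto simp: V_def g_def \<open>S {} = 0\<close>)
    then have "real (a + 1) \<le> real (2 ^ n)" by (intro of_nat_mono) linarith
    with a show "S I \<le> 2 ^ n - 1" by simp
  next
    obtain T where "T \<subseteq> I" "2 * real (2 ^ n - 1) - (2 ^ n - 1) = S I - 2 * S T"
      using rep[of "2 ^ n - 1"] by auto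
    moreover have "S T \<ge> 0" by (auto simp: S_def sum_nonneg)
    moreover have "real (2 ^ n - 1) = 2 ^ n - 1" by (simp add: of_nat_diff)
    ultimately show "2 ^ n - 1 \<le> S I" by linarith
  qed
  have S_ran: "\<exists>T. T \<subseteq> I \<and> S T = real a" if "a < 2 ^ n" for a
  proof -
    \<comment> \<open>Now \<open>g T\<close> is \<open>2 ^ n - 1 - 2 * S T\<close>, so the subset
      sum \<open>a\<close> belongs to the reflected index \<open>2 ^ n - 1 - a\<close>.\<close>
    have "2 ^ n - 1 - a < (2 :: nat) ^ n" using that by linarith
    then obtain T where T: "T \<subseteq> I" "2 * real (2 ^ n - 1 - a) - (2 ^ n - 1) = S I - 2 * S T"
      using rep[of "2 ^ n - 1 - a"] by auto
    have "real (2 ^ n - 1 - a) = 2 ^ n - 1 - real a" using that by (simp add: of_nat_diff)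
    with T SI show ?thesis by (intro exI[of _ T]) simp
  qed
  have S_nat: "\<exists>a. S T = real a" if "T \<subseteq> I" for T
  proof -
    have "g T \<in> V" using that V by blast
    then obtain a :: nat where "a < 2 ^ n" "2 ^ n - 1 - 2 * S T = 2 * real a - (2 ^ n - 1)"
      by (auto simp: V_def g_def SI)
    then have "S T = real (2 ^ n - 1 - a)" by (simp add: of_nat_diff)
    then show ?thesis by blast
  qed
  have "\<exists>J\<subseteq>I. (\<lambda>i. \<bar>C i\<bar>) ` J = (\<lambda>j. 2 ^ j) ` {..<k} \<and> S ` Pow J = real ` {..<2 ^ k}"
    if "k \<le> n" for k
    using that
  proof (induction k)
    case 0
    show ?case by (intro exI[of _ "{}"]) (auto simp: \<open>S {} = 0\<close>)
  next
    case (Suc k)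
    then obtain J where J: "J \<subseteq> I" "(\<lambda>i. \<bar>C i\<bar>) ` J = (\<lambda>j. 2 ^ j) ` {..<k}"
      "S ` Pow J = real ` {..<2 ^ k}" by auto
    have finJ: "finite J" using J(1) I(1) finite_subset by blast
    have "(2::nat) ^ k < 2 ^ n" using Suc.prems by simp
    then obtain T where T: "T \<subseteq> I" "S T = 2 ^ k" using S_ran[of "2 ^ k"] by auto
    \<comment> \<open>A set with sum \<open>2 ^ k\<close> needs some \<open>i\<close> outside
      \<open>J\<close>, whose weight is at most \<open>2 ^ k\<close>. A smaller weight would already
      be a subset sum of \<open>J\<close>, against injectivity of \<open>S\<close>.\<close>
    have "\<not> T \<subseteq> J"
    proof
      assume "T \<subseteq> J"
      then have "S T \<in> real ` {..<2 ^ k}" using J(3) by blast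
      then obtain b :: nat where "b < 2 ^ k" "real b = 2 ^ k" using T by auto
      then show False by (metis less_irrefl of_nat_eq_iff of_nat_numeral of_nat_power)
    qed
    then obtain i where i: "i \<in> T" "i \<notin> J" by blast
    then have iI: "i \<in> I" using T by blast
    have Si: "S {i} = \<bar>C i\<bar>" by (simp add: S_def)
    have "\<bar>C i\<bar> \<le> 2 ^ k" using S_mono[of "{i}" T] T i Si by simp
    moreover have "\<not> \<bar>C i\<bar> < 2 ^ k"
    proof
      assume lt: "\<bar>C i\<bar> < 2 ^ k"
      obtain a where a: "\<bar>C i\<bar> = real a" using S_nat[of "{i}"] iI Si by auto
      with lt have "a < 2 ^ k" by (metis of_nat_less_iff of_nat_numeral of_nat_power)
      then have "S {i} \<in> S ` Pow J" unfolding J(3) Si a by blast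
      then obtain T' where "T' \<subseteq> J" "S {i} = S T'" by blast
      then show False using inj_S[of "{i}" T'] iI J(1) i(2) by auto
    qed
    ultimately have Ci: "\<bar>C i\<bar> = 2 ^ k" by linarith
    have "S ` Pow (insert i J) = real ` {..<2 ^ k} \<union> (\<lambda>x. 2 ^ k + x) ` real ` {..<2 ^ k}"
    proof -
      have "S (insert i T') = 2 ^ k + S T'" if "T' \<subseteq> J" for T'
        unfolding S_def using that i(2) finJ Ci by (subst sum.insert) (auto dest: finite_subset)
      then have "S ` insert i ` Pow J = (\<lambda>x. 2 ^ k + x) ` S ` Pow J"
        unfolding image_image by (intro image_cong) auto
      then show ?thesis using J(3) by (simp add: Pow_insert image_Un)
    qed
    also have "(\<lambda>x. 2 ^ k + x) ` real ` {..<2 ^ k} = real ` (\<lambda>x. x + 2 ^ k) ` {..<2 ^ k}"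
      by (simp add: image_image add.commute)
    also have "(\<lambda>x. x + 2 ^ k) ` {..<2 ^ k} = {2 ^ k..<2 ^ Suc k :: nat}"
      by (simp add: lessThan_atLeast0 image_add_atLeastLessThan' mult_2)
    also have "real ` {..<2 ^ k} \<union> real ` {2 ^ k..<2 ^ Suc k} = real ` {..<2 ^ Suc k}"
      unfolding image_Un[symmetric] by (rule arg_cong[where f = "(`) real"]) auto
    finally have "S ` Pow (insert i J) = real ` {..<2 ^ Suc k}" .
    moreover have "(\<lambda>i. \<bar>C i\<bar>) ` insert i J = (\<lambda>j. 2 ^ j) ` {..<Suc k}"
      using J(2) Ci by (simp add: lessThan_Suc)
    ultimately show ?case using J(1) iI by (intro exI[of _ "insert i J"]) auto
  qed
  \<comment> \<open>At \<open>k = n\<close> the set \<open>J\<close> carries \<open>n\<close>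
    different weights, so it is all of \<open>I\<close>.\<close>
  from this[of n] obtain J where J: "J \<subseteq> I" "(\<lambda>i. \<bar>C i\<bar>) ` J = (\<lambda>j. 2 ^ j) ` {..<n}" by auto
  have inj2: "inj_on (\<lambda>j. (2::real) ^ j) {..<n}" by (auto simp: inj_on_def)
  have "n = card ((\<lambda>i. \<bar>C i\<bar>) ` J)" using J(2) inj2 by (simp add: card_image)
  also have "\<dots> \<le> card J" using J(1) I finite_subset by (intro card_image_le) blast
  finally have "J = I" using J(1) I by (intro card_seteq) auto
  then have im: "(\<lambda>i. \<bar>C i\<bar>) ` I = (\<lambda>j. 2 ^ j) ` {..<n}" using J by simp
  have injC: "inj_on (\<lambda>i. \<bar>C i\<bar>) I"
    using I im inj2 by (intro eq_card_imp_inj_on) (auto simp: card_image)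
  have "\<forall>i\<in>I. \<exists>j<n. \<bar>C i\<bar> = 2 ^ j" using im by auto
  then obtain \<pi> where \<pi>: "\<And>i. i \<in> I \<Longrightarrow> \<pi> i < n \<and> \<bar>C i\<bar> = 2 ^ \<pi> i" by metis
  have "inj_on \<pi> I" using injC \<pi> by (metis inj_on_def)
  moreover have "\<pi> ` I \<subseteq> {..<n}" using \<pi> by auto
  moreover have "\<pi> ` I = {..<n}"
    using calculation I by (intro card_subset_eq) (auto simp: card_image)
  ultimately show ?thesis using \<pi> by (auto simp: bij_betw_def)
qed

subsection \<open>The label graph\<close>

definition label_graph :: "nat \<Rightarrow> nat sgraph" where
  "label_graph n =
     \<lparr>verts = {1..2 ^ n},
      adj = (\<lambda>a b. a \<in> {1..2 ^ n} \<and> b \<in> {1..2 ^ n} \<and> a \<noteq> b \<and>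
                   card {j. j < n \<and> bit (a - 1) j = bit (b - 1) j} \<le> 1)\<rparr>"

lemma verts_label_graph [simp]: "verts (label_graph n) = {1..2 ^ n}"
  by (simp add: label_graph_def)

lemma label_eq_iff_bits:
  fixes a b :: nat
  assumes "a \<in> {1..2 ^ n}" "b \<in> {1..2 ^ n}"
  shows "a = b \<longleftrightarrow> (\<forall>j<n. bit (a - 1) j = bit (b - 1) j)"
proof
  assume bits: "\<forall>j<n. bit (a - 1) j = bit (b - 1) j"
  have "take_bit n (a - 1) = take_bit n (b - 1)"
    using bits by (auto simp: bit_eq_iff bit_take_bit_iff)
  moreover have "a - 1 < 2 ^ n" "b - 1 < 2 ^ n" using assms by auto
  ultimately have "a - 1 = b - 1" by (simp add: take_bit_nat_eq_self)
  with assms show "a = b" by auto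
qed simp

lemma label_eq_sum_bits:
  fixes a :: nat
  assumes "a \<in> {1..2 ^ n}"
  shows "a - 1 = (\<Sum>j<n. of_bool (bit (a - 1) j) * 2 ^ j)"
proof -
  have "a - 1 < 2 ^ n" using assms by auto
  then have "a - 1 = take_bit n (a - 1)" by (simp add: take_bit_nat_eq_self)
  then show ?thesis
    by (simp add: horner_sum_bit_eq_take_bit[symmetric] horner_sum_eq_sum lessThan_atLeast0)
qed

text \<open>A place \<open>j\<close> common to both edges is the only place where either edge
  agrees. Elsewhere \<open>a\<close> and \<open>c\<close> are both complementary to
  \<open>b\<close>, so they agree everywhere and coincide.\<close>

lemma label_graph_three_bits:
  assumes "adj (label_graph n) a b" "adj (label_graph n) b c" "a \<noteq> c" "j < n"
  shows "\<not> (bit (a - 1) j = bit (b - 1) j \<and> bit (b - 1) j = bit (c - 1) j)"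
proof
  assume eq: "bit (a - 1) j = bit (b - 1) j \<and> bit (b - 1) j = bit (c - 1) j"
  have ne: "bit (a - 1) i \<noteq> bit (b - 1) i"
    if "adj (label_graph n) a b" "bit (a - 1) j = bit (b - 1) j" "i < n" "i \<noteq> j" for a b i
  proof
    assume "bit (a - 1) i = bit (b - 1) i"
    then have "card {i, j} \<le> card {j. j < n \<and> bit (a - 1) j = bit (b - 1) j}"
      using that \<open>j < n\<close> by (intro card_mono) auto
    with that show False by (simp add: label_graph_def)
  qed
  have "bit (a - 1) i = bit (c - 1) i" if "i < n" for i
    using ne[OF assms(1), of i] ne[OF assms(2), of i] eq that by (cases "i = j") auto
  moreover have "a \<in> {1..2 ^ n}" "c \<in> {1..2 ^ n}"
    using assms by (auto simp: label_graph_def)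
  ultimately have "a = c" using label_eq_iff_bits by blast
  with assms show False by simp
qed

text \<open>Any three vertices of a 4-cycle are consecutive, so at each place two bits are set and
  two are not. Place \<open>j\<close> contributes \<open>2 * 2 ^ j\<close> to the sum of the
  predecessors.\<close>

lemma four_cycle_label_graph_sum:
  assumes "four_cycle (label_graph n) a b c d"
  shows "a + b + c + d = 2 * (2 ^ n + 1)"
proof -
  have adj: "adj (label_graph n) a b" "adj (label_graph n) b c"
    "adj (label_graph n) c d" "adj (label_graph n) d a"
    and ne: "a \<noteq> c" "b \<noteq> d"
    using assms by (auto simp: four_cycle_def)
  then have ran: "a \<in> {1..2 ^ n}" "b \<in> {1..2 ^ n}" "c \<in> {1..2 ^ n}" "d \<in> {1..2 ^ n}"
    by (auto simp: label_graph_def)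
  let ?b = "\<lambda>a j. of_bool (bit (a - 1) j) :: nat"
  have bits: "?b a j + ?b b j + ?b c j + ?b d j = 2" if "j < n" for j
    using label_graph_three_bits[OF adj(1,2) ne(1) that] label_graph_three_bits[OF adj(2,3) ne(2) that]
      label_graph_three_bits[OF adj(3,4) ne(1)[symmetric] that]
      label_graph_three_bits[OF adj(4,1) ne(2)[symmetric] that]
    by (auto simp: of_bool_def)
  have "(a - 1) + (b - 1) + (c - 1) + (d - 1) =
      (\<Sum>j<n. ?b a j * 2 ^ j) + (\<Sum>j<n. ?b b j * 2 ^ j) + (\<Sum>j<n. ?b c j * 2 ^ j) + (\<Sum>j<n. ?b d j * 2 ^ j)"
    using ran[THEN label_eq_sum_bits] by presburger
  also have "\<dots> = (\<Sum>j<n. (?b a j + ?b b j + ?b c j + ?b d j) * 2 ^ j)"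
    by (simp only: sum.distrib distrib_right)
  also have "\<dots> = (\<Sum>j<n. 2 * 2 ^ j)"
    by (rule sum.cong) (simp_all only: bits lessThan_iff)
  also have "\<dots> = 2 * (2 ^ n - 1)"
    by (simp add: sum_distrib_left[symmetric] mask_eq_sum_exp_nat[symmetric] lessThan_def)
  finally have "(a - 1) + (b - 1) + (c - 1) + (d - 1) = 2 * (2 ^ n - 1)" .
  moreover have "a = (a - 1) + 1" "b = (b - 1) + 1" "c = (c - 1) + 1" "d = (d - 1) + 1"
    using ran by auto
  moreover have "(2::nat) ^ n = (2 ^ n - 1) + 1" by simp
  \<comment> \<open>The truncated differences and the power become variables, which leaves a purely
    linear identity.\<close>
  moreover have "a + b + c + d = 2 * (N + 1)"
    if "a' + b' + c' + d' = 2 * N'" "a = a' + 1" "b = b' + 1" "c = c' + 1" "d = d' + 1" "N = N' + 1"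
    for a' b' c' d' N N' :: nat
    using that by simp
  ultimately show ?thesis by blast
qed

section \<open>Pulling labelings back along embeddings of the cube\<close>

lemma embeddings_four_cycle:
  assumes "\<phi> \<in> embeddings G H" "simple_graph G" "four_cycle G a b c d"
  shows "four_cycle H (\<phi> a) (\<phi> b) (\<phi> c) (\<phi> d)"
proof -
  have "a \<in> verts G" "b \<in> verts G" "c \<in> verts G" "d \<in> verts G"
    using assms(2,3) by (auto simp: four_cycle_def simple_graph_def)
  with assms show ?thesis
    by (auto simp: four_cycle_def embeddings_def dest: inj_onD)
qed

lemma embeddings_bij_betw:
  assumes "\<phi> \<in> embeddings (hypercube n) G" "finite (verts G)" "card (verts G) = 2 ^ n"
  shows "bij_betw \<phi> (cube_verts n) (verts G)"
proof -
  have "inj_on \<phi> (cube_verts n)" "\<phi> ` cube_verts n \<subseteq> verts G"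
    using assms(1) by (auto simp: embeddings_def)
  moreover from this have "\<phi> ` cube_verts n = verts G"
    using assms(2,3) by (intro card_subset_eq) (auto simp: card_image card_cube_verts)
  ultimately show ?thesis by (simp add: bij_betw_def)
qed

lemma magic_faced_compose:
  assumes A: "A \<in> magic_faced n G" and G: "finite (verts G)" "card (verts G) = 2 ^ n"
    and \<phi>: "\<phi> \<in> embeddings (hypercube n) G"
  shows "compose (verts (hypercube n)) A \<phi> \<in> magic_faced n (hypercube n)"
proof -
  have bij: "bij_betw A (verts G) {1..2 ^ n}"
    using A by (simp add: magic_faced_def)
  obtain s where s: "\<And>a b c d. four_cycle G a b c d \<Longrightarrow> A a + A b + A c + A d = s"
    using A by (auto simp: magic_faced_def)
  have "bij_betw (compose (cube_verts n) A \<phi>) (cube_verts n) {1..2 ^ n}"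
    using bij_betw_trans[OF embeddings_bij_betw[OF \<phi> G] bij]
    by (subst bij_betw_cong[of _ _ "A \<circ> \<phi>"]) (auto simp: compose_def)
  moreover have "compose (cube_verts n) A \<phi> a + compose (cube_verts n) A \<phi> b +
      compose (cube_verts n) A \<phi> c + compose (cube_verts n) A \<phi> d = s"
    if "four_cycle (hypercube n) a b c d" for a b c d
  proof -
    have "a \<in> cube_verts n" "b \<in> cube_verts n" "c \<in> cube_verts n" "d \<in> cube_verts n"
      using that by (auto simp: four_cycle_def hypercube_def)
    with s[OF embeddings_four_cycle[OF \<phi> simple_graph_hypercube that]] show ?thesis
      by (simp add: compose_def)
  qed
  ultimately show ?thesis
    unfolding magic_faced_def by (auto simp: compose_def)
qed

text \<open>The label graph is labelled by its own vertices; composing with this labeling shows that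
  embeddings of the cube into it are magic.\<close>

lemma restrict_id_magic_label_graph:
  "restrict id {1..2 ^ n} \<in> magic_faced n (label_graph n)"
proof -
  have "restrict id {1..2 ^ n} a + restrict id {1..2 ^ n} b + restrict id {1..2 ^ n} c
      + restrict id {1..2 ^ n} d = 2 * (2 ^ n + 1)"
    if cyc: "four_cycle (label_graph n) a b c d" for a b c d
    using four_cycle_label_graph_sum[OF cyc] cyc by (auto simp: four_cycle_def label_graph_def)
  moreover have "bij_betw (restrict id {1..2 ^ n}) {1..2 ^ n} {1..2 ^ n :: nat}"
    by (auto simp: bij_betw_def inj_on_def)
  ultimately show ?thesis
    unfolding magic_faced_def by auto
qed

lemma embeddings_label_graph_magic:
  assumes "\<phi> \<in> embeddings (hypercube n) (label_graph n)"
  shows "\<phi> \<in> magic_faced n (hypercube n)"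
proof -
  have "compose (verts (hypercube n)) (restrict id {1..2 ^ n}) \<phi> = \<phi>"
    using assms by (fastforce simp: compose_def embeddings_def PiE_def extensional_def)
  with magic_faced_compose[OF restrict_id_magic_label_graph _ _ assms] show ?thesis
    by simp
qed

subsection \<open>Magic-faced hypercubes as embeddings\<close>

locale magic_hypercube =
  fixes n :: nat and A :: "bool list \<Rightarrow> nat"
  assumes magic: "A \<in> magic_faced n (hypercube n)"
begin

lemma bij: "bij_betw A (cube_verts n) {1..2 ^ n}"
  using magic by (simp add: magic_faced_def)

definition f :: "bool list \<Rightarrow> real" where
  "f w = 2 * real (A w) - (2 ^ n + 1)"

text \<open>Reversing the labels by \<open>a\<close> to \<open>2 ^ n + 1 - a\<close> negates their
  centred values.\<close>

lemma sum_symmetric: "(\<Sum>w\<in>cube_verts n. g (f w)) = (\<Sum>w\<in>cube_verts n. g (- f w))"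
  for g :: "real \<Rightarrow> real"
proof -
  have "(\<Sum>w\<in>cube_verts n. g (f w)) = (\<Sum>a\<in>{1..2 ^ n}. g (2 * real a - (2 ^ n + 1)))"
    unfolding f_def by (rule sum.reindex_bij_betw[OF bij])
  also have "\<dots> = (\<Sum>a\<in>{1..2 ^ n}. g (- (2 * real a - (2 ^ n + 1))))"
    by (rule sum.reindex_bij_witness[of _ "\<lambda>a. 2 ^ n + 1 - a" "\<lambda>a. 2 ^ n + 1 - a"])
       (auto simp: of_nat_diff algebra_simps)
  also have "\<dots> = (\<Sum>w\<in>cube_verts n. g (- f w))"
    unfolding f_def by (rule sum.reindex_bij_betw[OF bij, symmetric])
  finally show ?thesis .
qed

lemma sum_f: "(\<Sum>w\<in>cube_verts n. f w) = 0"
  using sum_symmetric[of id] by (simp add: sum_negf)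

lemma sum_flip: "i < n \<Longrightarrow> (\<Sum>w\<in>cube_verts n. g (flip i w)) = (\<Sum>w\<in>cube_verts n. g w)"
  by (rule sum.reindex_bij_witness[of _ "flip i" "flip i"]) (auto simp: mem_cube_verts)

text \<open>All face sums of \<open>f\<close> share one value \<open>s'\<close>. Summing over all
  \<open>w\<close> gives \<open>2 ^ n * s'\<close> on one side and four times the sum of
  \<open>f\<close>, which is 0, on the other.\<close>

lemma face:
  assumes "length w = n" "i < j" "j < n"
  shows "f w + f (flip i w) + f (flip j w) + f (flip i (flip j w)) = 0"
proof -
  obtain s where s: "\<And>a b c d. four_cycle (hypercube n) a b c d \<Longrightarrow> A a + A b + A c + A d = s"
    using magic by (auto simp: magic_faced_def)
  have comm: "flip i (flip j w) = flip j (flip i w)" if "length w = n" for w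
    using that assms by (intro nth_equalityI) (auto simp: nth_flip)
  define s' where "s' = 2 * real s - 4 * (2 ^ n + 1)"
  have const: "f w + f (flip i w) + f (flip j w) + f (flip i (flip j w)) = s'"
    if len: "length w = n" for w
  proof -
    have "adj (hypercube n) (flip i (flip j w)) (flip i w)"
      unfolding adj_hypercube_iff using assms(2,3) len comm[OF len]
      by (metis flip_flip length_flip)
    then have 4: "four_cycle (hypercube n) w (flip j w) (flip i (flip j w)) (flip i w)"
    proof -
      have "w \<noteq> flip i (flip j w)" "flip j w \<noteq> flip i w"
        using assms len nth_flip[of j w i] nth_flip[of j w j] nth_flip[of j "flip j w" i]
        by (metis length_flip less_irrefl)+
      moreover have "adj (hypercube n) (flip i w) w"
        unfolding adj_hypercube_iff using assms len by (metis flip_flip length_flip less_trans)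
      moreover have "adj (hypercube n) w (flip j w)" "adj (hypercube n) (flip j w) (flip i (flip j w))"
        unfolding adj_hypercube_iff using assms(2,3) len by (auto intro: exI[of _ i])
      ultimately show ?thesis
        using \<open>adj (hypercube n) (flip i (flip j w)) (flip i w)\<close> simple_graph_hypercube[of n]
        unfolding four_cycle_def simple_graph_def by (metis distinct_length_2_or_more distinct_singleton)
    qed
    have "real (A w + A (flip j w) + A (flip i (flip j w)) + A (flip i w)) = real s"
      using s[OF 4] by simp
    then show ?thesis unfolding f_def s'_def by simp
  qed
  have "(\<Sum>w\<in>cube_verts n. f w + f (flip i w) + f (flip j w) + f (flip i (flip j w))) =
      (\<Sum>w\<in>cube_verts n. s')"
    by (rule sum.cong) (simp_all add: const mem_cube_verts)
  moreover have "(\<Sum>w\<in>cube_verts n. f w + f (flip i w) + f (flip j w) + f (flip i (flip j w))) = 0"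
    using assms(2,3) sum_flip[of i f] sum_flip[of j f] sum_flip[of j "\<lambda>w. f (flip i w)"] sum_f
    by (simp add: sum.distrib)
  ultimately have "s' = 0" by (simp add: card_cube_verts)
  with const[OF assms(1)] show ?thesis by simp
qed

text \<open>Each flip negates \<open>chi\<close>, so multiplication by \<open>chi\<close> turns face
  sums of \<open>f\<close> into mixed second differences.\<close>

lemma f_eq:
  "\<exists>c0 c. \<forall>w. length w = n \<longrightarrow> f w = chi w * (c0 + (\<Sum>i<n. c i * sgn_of (w ! i)))"
proof -
  define h where "h w = chi w * f w" for w
  have "\<exists>c0 c. \<forall>w. length w = n \<longrightarrow> h w = c0 + (\<Sum>i<n. c i * sgn_of (w ! i))"
  proof (rule affine_if_second_differences_zero)
    fix w :: "bool list" and i j assume w: "length w = n" "i < j" "j < n"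
    then have "h w + h (flip i (flip j w)) - (h (flip i w) + h (flip j w)) =
        chi w * (f w + f (flip i w) + f (flip j w) + f (flip i (flip j w)))"
      by (simp add: h_def chi_flip algebra_simps)
    with face[OF w] show "h w + h (flip i (flip j w)) = h (flip i w) + h (flip j w)" by simp
  qed
  then obtain c0 c where h: "\<And>w. length w = n \<Longrightarrow> h w = c0 + (\<Sum>i<n. c i * sgn_of (w ! i))"
    by blast
  have "f w = chi w * (c0 + (\<Sum>i<n. c i * sgn_of (w ! i)))" if "length w = n" for w
    unfolding h[OF that, symmetric] h_def by (simp add: mult.assoc[symmetric])
  then show ?thesis by blast
qed

text \<open>The constant coefficient is filed under index \<open>n\<close>.\<close>
lemma f_eq_signed_sum:
  "\<exists>C k. k \<le> n \<and> C k = 0 \<and>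
     (\<forall>w. length w = n \<longrightarrow> f w = (\<Sum>i\<le>n. C i * (chi w * (if i = n then 1 else sgn_of (w ! i)))))"
proof -
  obtain c0 c where f: "\<And>w. length w = n \<Longrightarrow> f w = chi w * (c0 + (\<Sum>i<n. c i * sgn_of (w ! i)))"
    using f_eq by blast
  define P where "P = (\<Prod>i<n. exp (c i) - exp (- c i))"
  have "(\<Sum>w\<in>cube_verts n. exp (f w) - exp (- f w)) = 0"
    using sum_symmetric[of exp] by (simp add: sum_subtractf)
  \<comment> \<open>The left side is odd in \<open>f w\<close>, so the sign \<open>chi w\<close> can
    be pulled out of the exponents.\<close>
  moreover have "exp (f w) - exp (- f w) =
      chi w * exp (c0 + (\<Sum>i<n. c i * sgn_of (w ! i))) -
      chi w * exp (- c0 + (\<Sum>i<n. - c i * sgn_of (w ! i)))" if "w \<in> cube_verts n" for w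
    using chi_cases[of w] that by (auto simp: f mem_cube_verts sum_negf)
  ultimately have "exp c0 * P - exp (- c0) * (\<Prod>i<n. exp (- c i) - exp (- (- c i))) = 0"
    unfolding P_def sum_chi_exp[symmetric] by (simp add: sum_subtractf)
  \<comment> \<open>Negating all coefficients changes the sign of each of the \<open>n\<close>
    factors.\<close>
  moreover have "(\<Prod>i<n. exp (- c i) - exp (- (- c i))) = (\<Prod>i<n. - 1 * (exp (c i) - exp (- c i)))"
    by simp
  then have "(\<Prod>i<n. exp (- c i) - exp (- (- c i))) = (- 1) ^ n * P"
    unfolding P_def prod.distrib by simp
  ultimately have "P * (exp c0 - (- 1) ^ n * exp (- c0)) = 0"
    by (simp add: algebra_simps)
  then consider "P = 0" | "exp c0 = (- 1) ^ n * exp (- c0)" by auto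
  then have "\<exists>k\<le>n. (if k = n then c0 else c k) = 0"
  proof cases
    case 1
    then obtain i where "i < n" "exp (c i) = exp (- c i)" by (auto simp: P_def)
    then show ?thesis by (intro exI[of _ i]) simp
  next
    case 2
    \<comment> \<open>Both exponentials are positive, so the sign must be 1; injectivity of
      \<open>exp\<close> then gives \<open>c0 = 0\<close>.\<close>
    then have "exp c0 = exp (- c0)"
      using exp_gt_zero[of c0] exp_gt_zero[of "- c0"] by (cases "even n") auto
    then show ?thesis by auto
  qed
  then obtain k where "k \<le> n" "(if k = n then c0 else c k) = 0" by blast
  moreover have "f w = (\<Sum>i\<le>n. (if i = n then c0 else c i) * (chi w * (if i = n then 1 else sgn_of (w ! i))))"
    if "length w = n" for w
    unfolding f[OF that] lessThan_Suc_atMost[symmetric] sum.lessThan_Suc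
    by (simp add: distrib_left sum_distrib_left mult_ac)
  ultimately show ?thesis
    by (intro exI[of _ "\<lambda>i. if i = n then c0 else c i"] exI[of _ k]) simp
qed

text \<open>Bit \<open>\<pi> i\<close> of the predecessor of the label is the sign of the term
  \<open>C i * y w i\<close>. Flipping coordinate \<open>j\<close> negates \<open>chi\<close> and
  hence every \<open>y w i\<close> except for \<open>i = j\<close>, where two sign changes cancel.
  If \<open>j\<close> is the removed index \<open>k\<close>, all bits change.\<close>

lemma adj_label_graph:
  assumes uv: "adj (hypercube n) u v"
  shows "adj (label_graph n) (A u) (A v)"
proof -
  obtain C k where k: "k \<le> n" "C k = 0" and
    f: "\<And>w. length w = n \<Longrightarrow> f w = (\<Sum>i\<le>n. C i * (chi w * (if i = n then 1 else sgn_of (w ! i))))"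
    using f_eq_signed_sum by blast
  define y where "y w i = chi w * (if i = n then 1 else sgn_of (w ! i))" for w i
  define I where "I = {..n} - {k}"
  have I: "finite I" "card I = n" using k by (auto simp: I_def)
  have f: "f w = (\<Sum>i\<in>I. C i * y w i)" if "length w = n" for w
    unfolding f[OF that] y_def I_def using k by (subst sum.remove[of _ k]) auto
  have y: "y w i = 1 \<or> y w i = - 1" for w i
    using chi_cases[of w] sgn_of_cases[of "w ! i"] by (auto simp: y_def)
  have "\<exists>\<pi>. bij_betw \<pi> I {..<n} \<and> (\<forall>i\<in>I. \<bar>C i\<bar> = 2 ^ \<pi> i)"
  proof (rule signed_sums_imp_powers_of_2[OF I])
    fix a :: nat assume "a < 2 ^ n"
    then have "Suc a \<in> A ` cube_verts n" using bij by (simp add: bij_betw_def)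
    then obtain w where "length w = n" "A w = Suc a" by (auto simp: mem_cube_verts)
    then have "2 * real a - (2 ^ n - 1) = (\<Sum>i\<in>I. C i * y w i)"
      using f[of w] by (simp add: f_def)
    with y show "\<exists>y. (\<forall>i\<in>I. y i = 1 \<or> y i = - 1) \<and> 2 * real a - (2 ^ n - 1) = (\<Sum>i\<in>I. C i * y i)"
      by blast
  qed
  then obtain \<pi> where \<pi>: "bij_betw \<pi> I {..<n}" "\<And>i. i \<in> I \<Longrightarrow> \<bar>C i\<bar> = 2 ^ \<pi> i" by blast
  have C0: "C i \<noteq> 0" if "i \<in> I" for i using \<pi>(2)[OF that] by auto
  have bit: "bit (A w - 1) (\<pi> i) \<longleftrightarrow> C i * y w i > 0" if w: "length w = n" and i: "i \<in> I" for w i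
  proof -
    \<comment> \<open>\<open>Q\<close> transports the signs of the terms to bit positions, so that
      the sum below can be read as a binary expansion.\<close>
    define Q where "Q p = (C (inv_into I \<pi> p) * y w (inv_into I \<pi> p) > 0)" for p
    have Q: "Q (\<pi> i) = (C i * y w i > 0)" if "i \<in> I" for i
      using \<pi>(1) that by (simp add: Q_def bij_betw_inv_into_left)
    have "A w \<ge> 1" using bij w by (auto simp: bij_betw_def mem_cube_verts)
    have "(\<Sum>i\<in>I. \<bar>C i\<bar>) = (\<Sum>p<n. 2 ^ p)"
      using sum.reindex_bij_betw[OF \<pi>(1), of "\<lambda>p. (2::real) ^ p"] \<pi>(2) by simp
    also have "\<dots> = 2 ^ n - 1" using geometric_sum[of "2::real" n] by simp
    \<comment> \<open>Adding all absolute values, \<open>2 ^ n - 1\<close> in total, kills the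
      negative terms and doubles the positive ones.\<close>
    finally have "2 * real (A w - 1) = (\<Sum>i\<in>I. C i * y w i + \<bar>C i\<bar>)"
      using f[OF w] \<open>A w \<ge> 1\<close> by (simp add: f_def sum.distrib of_nat_diff)
    also have "\<dots> = (\<Sum>i\<in>I. 2 * (of_bool (Q (\<pi> i)) * 2 ^ \<pi> i))"
    proof (rule sum.cong)
      fix i assume i: "i \<in> I"
      show "C i * y w i + \<bar>C i\<bar> = 2 * (of_bool (Q (\<pi> i)) * 2 ^ \<pi> i)"
        unfolding Q[OF i] \<pi>(2)[OF i, symmetric] using y[of w i] by auto
    qed simp
    also have "\<dots> = (\<Sum>p<n. 2 * (of_bool (Q p) * 2 ^ p))"
      by (rule sum.reindex_bij_betw[OF \<pi>(1)])
    finally have "real (A w - 1) = real (\<Sum>p<n. of_bool (Q p) * 2 ^ p)"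
      by (simp add: sum_distrib_left[symmetric])
    then have "A w - 1 = (\<Sum>p<n. of_bool (Q p) * 2 ^ p)" by (simp only: of_nat_eq_iff)
    also have "\<dots> = horner_sum of_bool 2 (map Q [0..<n])"
      by (simp add: horner_sum_eq_sum lessThan_atLeast0)
    finally have "bit (A w - 1) (\<pi> i) = Q (\<pi> i)"
      using bij_betw_apply[OF \<pi>(1) i] by (simp add: bit_horner_sum_bit_iff)
    with Q[OF i] show ?thesis by simp
  qed
  obtain j where j: "j < n" "v = flip j u" and "length u = n"
    using uv unfolding adj_hypercube_iff by blast
  then have len: "length u = n" "length v = n" by simp_all
  have "y v i = - y u i" if "i \<le> n" "i \<noteq> j" for i
    using that j len by (auto simp: y_def chi_flip nth_flip)
  then have "y v i = - y u i" if "i \<in> I" "i \<noteq> j" for i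
    using that by (simp add: I_def)
  then have ne: "bit (A u - 1) (\<pi> i) \<noteq> bit (A v - 1) (\<pi> i)" if "i \<in> I" "i \<noteq> j" for i
    unfolding bit[OF len(1) that(1)] bit[OF len(2) that(1)]
    using that C0[of i] y[of u i] by auto
  have "{p. p < n \<and> bit (A u - 1) p = bit (A v - 1) p} \<subseteq> {\<pi> j}"
  proof
    fix p assume "p \<in> {p. p < n \<and> bit (A u - 1) p = bit (A v - 1) p}"
    then have "p < n" "bit (A u - 1) p = bit (A v - 1) p" by simp_all
    moreover from this obtain i where "i \<in> I" "p = \<pi> i" using \<pi>(1) by (auto simp: bij_betw_def)
    ultimately show "p \<in> {\<pi> j}" using ne by blast
  qed
  then have "card {p. p < n \<and> bit (A u - 1) p = bit (A v - 1) p} \<le> 1"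
    using card_mono[of "{\<pi> j}"] by fastforce
  moreover have "u \<noteq> v" using uv simple_graph_hypercube by (auto simp: simple_graph_def)
  then have "A u \<noteq> A v" "A u \<in> {1..2 ^ n}" "A v \<in> {1..2 ^ n}"
    using bij len by (auto simp: bij_betw_def mem_cube_verts inj_on_def)
  ultimately show ?thesis by (simp add: label_graph_def)
qed

end

lemma magic_faced_hypercube:
  "magic_faced n (hypercube n) = embeddings (hypercube n) (label_graph n)"
proof (intro equalityI subsetI)
  fix A assume A: "A \<in> magic_faced n (hypercube n)"
  then interpret magic_hypercube n A by unfold_locales
  show "A \<in> embeddings (hypercube n) (label_graph n)"
    using A bij adj_label_graph
    by (auto simp: embeddings_def magic_faced_def bij_betw_def PiE_def)
qed (rule embeddings_label_graph_magic)

subsection \<open>Graphs isomorphic to the label graph\<close>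

text \<open>Extensional like the members of \<open>magic_faced\<close>, so that the two sets can be
  proved equal.\<close>

definition label_isos :: "nat \<Rightarrow> 'a sgraph \<Rightarrow> ('a \<Rightarrow> nat) set" where
  "label_isos n G =
     {A \<in> extensional (verts G). bij_betw A (verts G) {1..2 ^ n} \<and>
        (\<forall>u \<in> verts G. \<forall>v \<in> verts G. adj (label_graph n) (A u) (A v) \<longleftrightarrow> adj G u v)}"

text \<open>Magic labelings have been analysed on cubes only; an embedded cube through an edge
  carries that knowledge to the edge.\<close>

definition edges_covered :: "nat \<Rightarrow> 'a sgraph \<Rightarrow> bool" where
  "edges_covered n G \<longleftrightarrow>
     (\<forall>u v. adj G u v \<longrightarrow>
        (\<exists>\<psi> \<in> embeddings (hypercube n) G. \<exists>x y. adj (hypercube n) x y \<and> \<psi> x = u \<and> \<psi> y = v))"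

text \<open>Common setting for \<open>FQ_n\<close> and \<open>HFQ_n\<close>. The isomorphism
  \<open>A0\<close> supplies both existence and the count of edges.\<close>

locale labelled_graph =
  fixes n :: nat and G :: "'a sgraph" and A0 :: "'a \<Rightarrow> nat"
  assumes simple: "simple_graph G"
    and A0: "A0 \<in> label_isos n G"
    and covered: "edges_covered n G"
begin

lemma bij_A0: "bij_betw A0 (verts G) {1..2 ^ n}"
  using A0 by (simp add: label_isos_def)

lemma finite_verts: "finite (verts G)"
  using bij_betw_finite[OF bij_A0] by simp

lemma card_verts: "card (verts G) = 2 ^ n"
  using bij_betw_same_card[OF bij_A0] by simp

definition edges :: "('a \<times> 'a) set" where
  "edges = {(u, v). adj G u v}"

definition label_edges :: "(nat \<times> nat) set" where
  "label_edges = {(a, b). adj (label_graph n) a b}"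

lemma edges_subset: "edges \<subseteq> verts G \<times> verts G"
  using simple by (auto simp: edges_def simple_graph_def)

lemma label_edges_subset: "label_edges \<subseteq> {1..2 ^ n} \<times> {1..2 ^ n}"
  by (auto simp: label_edges_def label_graph_def)

lemma card_label_edges: "card label_edges = card edges"
proof -
  have "map_prod A0 A0 ` edges = label_edges"
  proof (intro equalityI subsetI)
    fix e assume "e \<in> map_prod A0 A0 ` edges"
    then show "e \<in> label_edges"
      using A0 edges_subset by (auto simp: edges_def label_edges_def label_isos_def)
  next
    fix e assume e: "e \<in> label_edges"
    then obtain a b where ab: "e = (a, b)" "a \<in> {1..2 ^ n}" "b \<in> {1..2 ^ n}"
      using label_edges_subset by blast
    then obtain u v where "u \<in> verts G" "v \<in> verts G" "a = A0 u" "b = A0 v"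
      using bij_betw_imp_surj_on[OF bij_A0] by (metis imageE)
    with e ab A0 show "e \<in> map_prod A0 A0 ` edges"
      by (force simp: edges_def label_edges_def label_isos_def)
  qed
  moreover have "inj_on (map_prod A0 A0) edges"
    using bij_A0 edges_subset by (auto simp: bij_betw_def intro: inj_on_subset map_prod_inj_on)
  ultimately show ?thesis by (metis card_image)
qed

lemma magic_preserves_edges:
  assumes A: "A \<in> magic_faced n G" and uv: "adj G u v"
  shows "adj (label_graph n) (A u) (A v)"
proof -
  obtain \<psi> x y where \<psi>: "\<psi> \<in> embeddings (hypercube n) G" "adj (hypercube n) x y" "\<psi> x = u" "\<psi> y = v"
    using covered uv unfolding edges_covered_def by meson
  have xy: "x \<in> cube_verts n" "y \<in> cube_verts n" using \<psi>(2) by (auto simp: hypercube_def)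
  have "compose (verts (hypercube n)) A \<psi> \<in> embeddings (hypercube n) (label_graph n)"
    using magic_faced_compose[OF A finite_verts card_verts \<psi>(1)] by (simp add: magic_faced_hypercube)
  then have "adj (label_graph n) (compose (verts (hypercube n)) A \<psi> x) (compose (verts (hypercube n)) A \<psi> y)"
    using \<psi>(2) by (simp add: embeddings_def)
  then show ?thesis using \<psi> xy by (simp add: compose_eq)
qed

text \<open>A magic labeling maps edges injectively to label edges. Both edge sets are finite of
  equal size, so this map is onto and non-edges are preserved as well. Conversely, an isomorphism
  inherits the constant sum from the label graph.\<close>

lemma magic_faced_eq: "magic_faced n G = label_isos n G"
proof (intro equalityI subsetI)
  fix A assume A: "A \<in> magic_faced n G"
  then have bij: "bij_betw A (verts G) {1..2 ^ n}" by (simp add: magic_faced_def)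
  have inj: "inj_on (map_prod A A) (verts G \<times> verts G)"
    using bij by (auto simp: bij_betw_def intro: map_prod_inj_on)
  have "map_prod A A ` edges \<subseteq> label_edges"
    using magic_preserves_edges[OF A] by (auto simp: edges_def label_edges_def)
  moreover have "finite label_edges"
    using label_edges_subset finite_subset by blast
  moreover have "card (map_prod A A ` edges) = card label_edges"
    using inj edges_subset card_label_edges by (metis card_image inj_on_subset)
  ultimately have im: "map_prod A A ` edges = label_edges"
    by (intro card_subset_eq)
  have "adj G u v" if "u \<in> verts G" "v \<in> verts G" "adj (label_graph n) (A u) (A v)" for u v
  proof -
    have "map_prod A A (u, v) \<in> map_prod A A ` edges"
      unfolding im using that by (simp add: label_edges_def)
    then have "(u, v) \<in> edges"
      using inj_on_image_mem_iff[OF inj _ edges_subset, of "(u, v)"] that by simp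
    then show ?thesis by (simp add: edges_def)
  qed
  with A magic_preserves_edges[OF A] show "A \<in> label_isos n G"
    by (auto simp: label_isos_def magic_faced_def)
next
  fix A assume A: "A \<in> label_isos n G"
  have "A a + A b + A c + A d = 2 * (2 ^ n + 1)" if cyc: "four_cycle G a b c d" for a b c d
  proof (rule four_cycle_label_graph_sum)
    have "{a, b, c, d} \<subseteq> verts G" using cyc simple by (auto simp: four_cycle_def simple_graph_def)
    with A cyc show "four_cycle (label_graph n) (A a) (A b) (A c) (A d)"
      by (auto simp: four_cycle_def label_isos_def bij_betw_def dest: inj_onD)
  qed
  with A show "A \<in> magic_faced n G" by (auto simp: label_isos_def magic_faced_def)
qed

lemma magic_nonempty: "magic_faced n G \<noteq> {}"
  using A0 magic_faced_eq by blast

text \<open>Two isomorphisms onto the same graph differ by an automorphism, here \<open>B\<close>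
  followed by the inverse of \<open>A\<close>.\<close>

lemma magic_unique:
  assumes "A \<in> magic_faced n G" "B \<in> magic_faced n G"
  shows "\<exists>\<sigma> \<in> automorphisms G. B = compose (verts G) A \<sigma>"
proof
  let ?\<sigma> = "compose (verts G) (inv_into (verts G) A) B"
  have A: "bij_betw A (verts G) {1..2 ^ n}"
      "\<And>u v. u \<in> verts G \<Longrightarrow> v \<in> verts G \<Longrightarrow> adj (label_graph n) (A u) (A v) \<longleftrightarrow> adj G u v"
    and B: "bij_betw B (verts G) {1..2 ^ n}" "B \<in> extensional (verts G)"
      "\<And>u v. u \<in> verts G \<Longrightarrow> v \<in> verts G \<Longrightarrow> adj (label_graph n) (B u) (B v) \<longleftrightarrow> adj G u v"
    using assms unfolding magic_faced_eq by (auto simp: label_isos_def)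
  have bij: "bij_betw ?\<sigma> (verts G) (verts G)"
    using bij_betw_trans[OF B(1) bij_betw_inv_into[OF A(1)]]
    by (subst bij_betw_cong[of _ _ "inv_into (verts G) A \<circ> B"]) (auto simp: compose_eq)
  have A\<sigma>: "A (?\<sigma> u) = B u" if "u \<in> verts G" for u
    using bij_betw_inv_into_right[OF A(1) bij_betw_apply[OF B(1) that]] that by (simp add: compose_eq)
  have mem: "?\<sigma> u \<in> verts G" if "u \<in> verts G" for u
    using bij that by (rule bij_betw_apply)
  show "B = compose (verts G) A ?\<sigma>"
    using A\<sigma> B(2) by (intro extensionalityI[of _ "verts G"]) (auto simp: compose_eq compose_extensional)
  have "adj G (?\<sigma> u) (?\<sigma> v) \<longleftrightarrow> adj G u v" if "u \<in> verts G" "v \<in> verts G" for u v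
    using A(2)[OF mem mem, OF that] B(3)[OF that] A\<sigma> that by simp
  with bij show "?\<sigma> \<in> automorphisms G"
    by (simp add: automorphisms_def compose_extensional)
qed

text \<open>Magic hypercubes are the embeddings into the label graph, and the isomorphism
  \<open>A\<close> identifies these with the embeddings into \<open>G\<close>; composing with its
  inverse goes back.\<close>

lemma magic_bij_embeddings:
  assumes "A \<in> magic_faced n G"
  shows "bij_betw (\<lambda>\<phi>. compose (verts (hypercube n)) A \<phi>)
     (embeddings (hypercube n) G) (magic_faced n (hypercube n))"
proof -
  have A: "bij_betw A (verts G) {1..2 ^ n}"
    "\<And>u v. u \<in> verts G \<Longrightarrow> v \<in> verts G \<Longrightarrow> adj (label_graph n) (A u) (A v) \<longleftrightarrow> adj G u v"
    using assms unfolding magic_faced_eq by (auto simp: label_isos_def)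
  let ?V = "cube_verts n"
  show ?thesis
    unfolding verts_hypercube
  proof (rule bij_betw_byWitness[where f' = "\<lambda>B. compose ?V (inv_into (verts G) A) B"])
    show "\<forall>\<phi>\<in>embeddings (hypercube n) G. compose ?V (inv_into (verts G) A) (compose ?V A \<phi>) = \<phi>"
    proof
      fix \<phi> assume "\<phi> \<in> embeddings (hypercube n) G"
      then have "\<phi> \<in> extensional ?V" "\<And>x. x \<in> ?V \<Longrightarrow> \<phi> x \<in> verts G"
        by (auto simp: embeddings_def PiE_def)
      then show "compose ?V (inv_into (verts G) A) (compose ?V A \<phi>) = \<phi>"
        using bij_betw_inv_into_left[OF A(1)]
        by (intro extensionalityI[of _ ?V]) (auto simp: compose_eq)
    qed
    show "\<forall>B\<in>magic_faced n (hypercube n). compose ?V A (compose ?V (inv_into (verts G) A) B) = B"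
    proof
      fix B assume "B \<in> magic_faced n (hypercube n)"
      then have "B \<in> extensional ?V" "\<And>x. x \<in> ?V \<Longrightarrow> B x \<in> {1..2 ^ n}"
        by (auto simp: magic_faced_def bij_betw_def)
      then show "compose ?V A (compose ?V (inv_into (verts G) A) B) = B"
        using bij_betw_inv_into_right[OF A(1)]
        by (intro extensionalityI[of _ ?V]) (simp_all add: compose_eq del: atLeastAtMost_iff)
    qed
    show "(\<lambda>\<phi>. compose ?V A \<phi>) ` embeddings (hypercube n) G \<subseteq> magic_faced n (hypercube n)"
      using magic_faced_compose[OF assms finite_verts card_verts] by auto
    show "(\<lambda>B. compose ?V (inv_into (verts G) A) B) ` magic_faced n (hypercube n) \<subseteq> embeddings (hypercube n) G"
    proof
      fix \<phi> assume "\<phi> \<in> (\<lambda>B. compose ?V (inv_into (verts G) A) B) ` magic_faced n (hypercube n)"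
      then obtain B where B: "B \<in> embeddings (hypercube n) (label_graph n)"
        and \<phi>: "\<phi> = compose ?V (inv_into (verts G) A) B"
        by (auto simp: magic_faced_hypercube)
      have B': "B \<in> ?V \<rightarrow>\<^sub>E {1..2 ^ n}" "inj_on B ?V" using B by (auto simp: embeddings_def)
      have mem: "\<phi> w \<in> verts G" "A (\<phi> w) = B w" if "w \<in> ?V" for w
      proof -
        have Bw: "B w \<in> {1..2 ^ n}" using B'(1) that by (rule PiE_mem)
        show "\<phi> w \<in> verts G"
          using that bij_betw_apply[OF bij_betw_inv_into[OF A(1)] Bw] by (simp add: \<phi> compose_eq)
        show "A (\<phi> w) = B w"
          using that bij_betw_inv_into_right[OF A(1) Bw] by (simp add: \<phi> compose_eq)
      qed
      have "\<phi> \<in> ?V \<rightarrow>\<^sub>E verts G" using mem by (auto simp: \<phi> compose_extensional PiE_def)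
      moreover have "inj_on \<phi> ?V" using B'(2) mem(2) by (metis inj_on_def)
      moreover have "adj G (\<phi> u) (\<phi> v)" if uv: "adj (hypercube n) u v" for u v
      proof -
        have "u \<in> ?V" "v \<in> ?V" using uv by (auto simp: hypercube_def)
        moreover have "adj (label_graph n) (B u) (B v)" using B uv by (simp add: embeddings_def)
        ultimately show ?thesis using A(2) mem by metis
      qed
      ultimately show "\<phi> \<in> embeddings (hypercube n) G" by (simp add: embeddings_def)
    qed
  qed
qed

end

subsection \<open>Folded hypercubes as label graphs\<close>

text \<open>Least significant bit first; the successor makes the range start at 1.\<close>

definition label_of_bits :: "bool list \<Rightarrow> nat" where
  "label_of_bits w = Suc (horner_sum of_bool 2 w)"

lemma bit_label_of_bits: "bit (label_of_bits w - Suc 0) j \<longleftrightarrow> j < length w \<and> w ! j"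
  by (simp add: label_of_bits_def bit_horner_sum_bit_iff)

lemma label_of_bits_range: "length w = n \<Longrightarrow> label_of_bits w \<in> {1..2 ^ n}"
  using horner_sum_of_bool_2_less[of w, where 'a = nat] by (auto simp: label_of_bits_def)

lemma label_of_bits_eq_iff:
  assumes "length v = length w"
  shows "label_of_bits v = label_of_bits w \<longleftrightarrow> v = w"
proof
  assume eq: "label_of_bits v = label_of_bits w"
  show "v = w"
  proof (rule nth_equalityI[OF assms])
    fix i assume "i < length v"
    then show "v ! i = w ! i"
      using bit_label_of_bits[of v i] bit_label_of_bits[of w i] eq assms by simp
  qed
qed simp

definition common_coords :: "bool list \<Rightarrow> bool list \<Rightarrow> nat set" where
  "common_coords u v = {..<length u} - diff_coords u v"

lemma adj_label_of_bits:
  assumes "length u = n" "length v = n"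
  shows "adj (label_graph n) (label_of_bits u) (label_of_bits v) \<longleftrightarrow>
    u \<noteq> v \<and> card (common_coords u v) \<le> 1"
proof -
  have "{j. j < n \<and> bit (label_of_bits u - 1) j = bit (label_of_bits v - 1) j} = common_coords u v"
    using assms by (auto simp: bit_label_of_bits common_coords_def diff_coords_def)
  then show ?thesis
    using assms label_of_bits_range[of u n] label_of_bits_range[of v n]
    by (simp add: label_graph_def label_of_bits_eq_iff del: atLeastAtMost_iff)
qed

lemma label_isosI:
  assumes len: "\<And>u. u \<in> verts G \<Longrightarrow> length (b u) = n"
    and inj: "inj_on b (verts G)" and G: "finite (verts G)" "card (verts G) = 2 ^ n"
    and adj: "\<And>u v. u \<in> verts G \<Longrightarrow> v \<in> verts G \<Longrightarrow>
      adj G u v \<longleftrightarrow> b u \<noteq> b v \<and> card (common_coords (b u) (b v)) \<le> 1"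
  shows "restrict (\<lambda>u. label_of_bits (b u)) (verts G) \<in> label_isos n G"
proof -
  have inj': "inj_on (\<lambda>u. label_of_bits (b u)) (verts G)"
    using len by (intro inj_onI) (metis inj inj_onD label_of_bits_eq_iff)
  moreover have "(\<lambda>u. label_of_bits (b u)) ` verts G = {1..2 ^ n}"
  proof (rule card_subset_eq)
    show "(\<lambda>u. label_of_bits (b u)) ` verts G \<subseteq> {1..2 ^ n}"
      using len label_of_bits_range by blast
    show "card ((\<lambda>u. label_of_bits (b u)) ` verts G) = card {1..2 ^ n :: nat}"
      using G inj' by (simp add: card_image)
  qed simp
  ultimately have "bij_betw (restrict (\<lambda>u. label_of_bits (b u)) (verts G)) (verts G) {1..2 ^ n}"
    by (simp add: bij_betw_def inj_on_restrict_eq)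
  then show ?thesis
    using len by (simp add: label_isos_def adj adj_label_of_bits)
qed

section \<open>Parity twists and the even case\<close>

primrec parity :: "bool list \<Rightarrow> bool" where
  "parity [] = False"
| "parity (b # w) = (b \<noteq> parity w)"

lemma diff_coords_Cons:
  "diff_coords (a # u) (b # v) = (if a = b then {} else {0}) \<union> Suc ` diff_coords u v"
proof (rule set_eqI)
  fix i
  show "i \<in> diff_coords (a # u) (b # v) \<longleftrightarrow> i \<in> (if a = b then {} else {0}) \<union> Suc ` diff_coords u v"
    by (cases i) (auto simp: diff_coords_def)
qed

lemma diff_coords_subset: "diff_coords u v \<subseteq> {..<length u}"
  by (auto simp: diff_coords_def)

lemma finite_diff_coords [simp]: "finite (diff_coords u v)"
  using diff_coords_subset finite_subset by blast

lemma card_diff_coords_Cons: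
  "card (diff_coords (a # u) (b # v)) = (if a = b then 0 else 1) + card (diff_coords u v)"
  unfolding diff_coords_Cons by (subst card_Un_disjoint) (auto simp: card_image)

lemma diff_coords_empty_iff: "length u = length v \<Longrightarrow> diff_coords u v = {} \<longleftrightarrow> u = v"
  by (auto simp: diff_coords_def list_eq_iff_nth_eq)

lemma parity_diff_coords:
  "length u = length v \<Longrightarrow> (parity u \<noteq> parity v) \<longleftrightarrow> odd (card (diff_coords u v))"
proof (induction u v rule: list_induct2)
  case Nil
  then show ?case by (simp add: diff_coords_def)
next
  case (Cons a u b v)
  then show ?case by (auto simp: card_diff_coords_Cons)
qed

text \<open>\<open>twist (parity u) u\<close> lists the bits of the label of \<open>u\<close> in \<open>FQ_n\<close>. Passing to a neighbour changes the
  parity in the \<open>Q_n\<close> edges but not in the antipodal ones (\<open>n\<close> even), so it changes all bits but at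
  most one. In \<open>HFQ_n\<close> the same works with \<open>False # u\<close>.\<close>
definition twist :: "bool \<Rightarrow> bool list \<Rightarrow> bool list" where
  "twist t w = map (\<lambda>x. x \<noteq> t) w"

lemma length_twist [simp]: "length (twist t w) = length w"
  by (simp add: twist_def)

text \<open>Complementing just one of two lists exchanges agreement and disagreement.\<close>

lemma common_coords_twist:
  assumes "length u = length v"
  shows "common_coords (twist s u) (twist t v) =
    (if s = t then {..<length u} - diff_coords u v else diff_coords u v)"
  using assms by (cases s; cases t) (auto simp: common_coords_def diff_coords_def twist_def)

lemma twist_eq_iff:
  assumes "length u = length v"
  shows "twist s u = twist t v \<longleftrightarrow> diff_coords u v = (if s = t then {} else {..<length u})"
  using assms by (cases s; cases t) (auto simp: list_eq_iff_nth_eq twist_def diff_coords_def)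

lemma card_compl_diff_coords:
  "card ({..<length u} - diff_coords u v) = length u - card (diff_coords u v)"
  by (simp add: card_Diff_subset diff_coords_subset)

lemma card_diff_coords_le: "card (diff_coords u v) \<le> length u"
  using card_mono[OF _ diff_coords_subset, of u v] by simp

lemma diff_coords_full_iff: "diff_coords u v = {..<length u} \<longleftrightarrow> card (diff_coords u v) = length u"
  by (metis card_lessThan card_subset_eq diff_coords_subset finite_lessThan)

lemma verts_folded_hypercube [simp]: "verts (folded_hypercube n) = cube_verts n"
  by (simp add: folded_hypercube_def)

lemma adj_folded_hypercube:
  assumes "length u = n" "length v = n"
  shows "adj (folded_hypercube n) u v \<longleftrightarrow>
    u \<noteq> v \<and> (card (diff_coords u v) = 1 \<or> card (diff_coords u v) = n)"
proof -
  have "card (diff_coords u v) = 1 \<Longrightarrow> u \<noteq> v"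
    using diff_coords_empty_iff[of u v] assms by force
  then show ?thesis
    using assms diff_coords_full_iff[of u v]
    by (auto simp: folded_hypercube_def hypercube_def mem_cube_verts)
qed

lemma card_diff_coords_eq_0:
  "length u = length v \<Longrightarrow> card (diff_coords u v) = 0 \<longleftrightarrow> u = v"
  by (simp add: diff_coords_empty_iff)

lemma folded_hypercube_label_iso:
  assumes "even n"
  shows "restrict (\<lambda>u. label_of_bits (twist (parity u) u)) (verts (folded_hypercube n))
    \<in> label_isos n (folded_hypercube n)"
proof (rule label_isosI)
  have eq: "twist (parity u) u = twist (parity v) v \<longleftrightarrow> u = v"
    if "length u = n" "length v = n" for u v
  proof (cases "parity u = parity v")
    case True
    then show ?thesis using that by (simp add: twist_eq_iff diff_coords_empty_iff)
  next
    case False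
    \<comment> \<open>The distance is odd and \<open>n\<close> even, so \<open>u\<close> and
      \<open>v\<close> are not antipodal; antipodal vertices with different twists would receive the
      same bits.\<close>
    then have "card (diff_coords u v) \<noteq> n" using that assms parity_diff_coords[of u v] by auto
    then have "diff_coords u v \<noteq> {..<length u}" using that diff_coords_full_iff[of u v] by simp
    moreover have "u \<noteq> v" using False by auto
    moreover have "length u = length v" using that by simp
    ultimately show ?thesis using False by (simp only: twist_eq_iff if_False)
  qed
  show "inj_on (\<lambda>u. twist (parity u) u) (verts (folded_hypercube n))"
    using eq by (intro inj_onI) (simp add: mem_cube_verts)
  fix u v assume "u \<in> verts (folded_hypercube n)" "v \<in> verts (folded_hypercube n)"
  then have len: "length u = n" "length v = n" by (auto simp: mem_cube_verts)
  let ?d = "card (diff_coords u v)"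
  have "card (common_coords (twist (parity u) u) (twist (parity v) v)) = (if even ?d then n - ?d else ?d)"
    using len parity_diff_coords[of u v] card_compl_diff_coords[of u v]
    by (cases "parity u = parity v") (simp_all add: common_coords_twist)
  moreover have "?d \<le> n" using card_diff_coords_le len by metis
  \<comment> \<open>For even \<open>?d\<close> the number \<open>n - ?d\<close> is even too, so at
    most 1 means 0.\<close>
  then have "(?d = 1 \<or> ?d = n) \<longleftrightarrow> (if even ?d then n - ?d else ?d) \<le> 1" if "?d \<noteq> 0"
    using assms that by (cases "even ?d"; simp; presburger)
  moreover have "?d \<noteq> 0 \<longleftrightarrow> u \<noteq> v" using len card_diff_coords_eq_0[of u v] by simp
  ultimately show "adj (folded_hypercube n) u v \<longleftrightarrow>
      twist (parity u) u \<noteq> twist (parity v) v \<and>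
      card (common_coords (twist (parity u) u) (twist (parity v) v)) \<le> 1"
    using len by (auto simp: adj_folded_hypercube eq)
qed (auto simp: mem_cube_verts card_cube_verts)

section \<open>The odd case\<close>

lemma verts_hier_folded_hypercube [simp]:
  "verts (hier_folded_hypercube (Suc m)) = UNIV \<times> cube_verts m"
  by (simp add: hier_folded_hypercube_def cartesian_product_def K2_def)

lemma adj_hier_folded_hypercube:
  "adj (hier_folded_hypercube (Suc m)) (a, u) (b, v) \<longleftrightarrow>
    a = b \<and> adj (folded_hypercube m) u v \<or> a \<noteq> b \<and> u = v \<and> length u = m"
  by (auto simp: hier_folded_hypercube_def cartesian_product_def K2_def mem_cube_verts)

lemma hier_folded_hypercube_label_iso:
  assumes "even m"
  shows "restrict (\<lambda>(b, u). label_of_bits (twist (b \<noteq> parity u) (False # u)))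
      (verts (hier_folded_hypercube (Suc m)))
    \<in> label_isos (Suc m) (hier_folded_hypercube (Suc m))"
proof -
  let ?t = "\<lambda>(b, u). twist (b \<noteq> parity u) (False # u)"
  have dFalse: "card (diff_coords (False # u) (False # v)) = card (diff_coords u v)" for u v
    by (simp add: card_diff_coords_Cons)
  have eq: "?t (a, u) = ?t (b, v) \<longleftrightarrow> (a, u) = (b, v)"
    if "length u = m" "length v = m" for u v a b
  proof (cases "(a \<noteq> parity u) = (b \<noteq> parity v)")
    case True
    then show ?thesis using that by (auto simp: twist_eq_iff diff_coords_empty_iff)
  next
    case False
    \<comment> \<open>The leading \<open>False\<close> is shared, so the padded lists are never
      complementary.\<close>
    have "card (diff_coords u v) \<noteq> Suc m" using that card_diff_coords_le[of u v] by simp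
    then have "diff_coords (False # u) (False # v) \<noteq> {..<length (False # u)}"
      using that unfolding diff_coords_full_iff dFalse by simp
    moreover have "(a, u) \<noteq> (b, v)" using False by auto
    moreover have "length (False # u) = length (False # v)" using that by simp
    ultimately show ?thesis using False by (simp only: twist_eq_iff if_False prod.case)
  qed
  have "restrict (\<lambda>u. label_of_bits (?t u)) (verts (hier_folded_hypercube (Suc m)))
    \<in> label_isos (Suc m) (hier_folded_hypercube (Suc m))"
  proof (rule label_isosI)
    show "inj_on ?t (verts (hier_folded_hypercube (Suc m)))"
    proof (rule inj_onI)
      fix x y assume "x \<in> verts (hier_folded_hypercube (Suc m))" "y \<in> verts (hier_folded_hypercube (Suc m))"
        and t: "?t x = ?t y"
      then obtain a u b v where xy: "x = (a, u)" "y = (b, v)" and "length u = m" "length v = m"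
        by (auto simp: mem_cube_verts)
      then show "x = y" using eq[of u v a b] t unfolding xy by blast
    qed
    fix x y assume "x \<in> verts (hier_folded_hypercube (Suc m))" "y \<in> verts (hier_folded_hypercube (Suc m))"
    then obtain a u b v where xy: "x = (a, u)" "y = (b, v)" and len: "length u = m" "length v = m"
      by (auto simp: mem_cube_verts)
    let ?d = "card (diff_coords u v)"
    have d: "?d \<le> m" using card_diff_coords_le len by metis
    \<comment> \<open>The twists agree exactly when \<open>(a = b) = even ?d\<close>. As
      \<open>m\<close> is even, distinct vertices have at most one common place only at distance 1
      or \<open>m\<close> if \<open>a = b\<close>, and only at distance 0 otherwise.\<close>
    have "card (common_coords (?t x) (?t y)) =
        (if (a = b) = even ?d then Suc m - ?d else ?d)"
      using len parity_diff_coords[of u v] card_compl_diff_coords[of "False # u" "False # v"] dFalse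
      unfolding xy by (auto simp: common_coords_twist)
    moreover have "?d \<noteq> 0 \<longleftrightarrow> u \<noteq> v" using len card_diff_coords_eq_0[of u v] by simp
    ultimately show "adj (hier_folded_hypercube (Suc m)) x y \<longleftrightarrow>
        ?t x \<noteq> ?t y \<and> card (common_coords (?t x) (?t y)) \<le> 1"
      unfolding xy eq[OF len] adj_hier_folded_hypercube adj_folded_hypercube[OF len]
      using len d assms by (cases "?d = m") (auto simp: le_Suc_eq)
  qed (auto simp: mem_cube_verts card_cube_verts card_cartesian_product)
  then show ?thesis by (simp add: case_prod_unfold)
qed

subsection \<open>Embedded cubes through a given edge\<close>

lemma restrict_id_embedding:
  "restrict id (cube_verts n) \<in> embeddings (hypercube n) (folded_hypercube n)"
  by (auto simp: embeddings_def folded_hypercube_def hypercube_def)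

text \<open>Sends the edges of \<open>Q_n\<close> in the first direction to antipodal pairs.\<close>
definition fold_head :: "bool list \<Rightarrow> bool list" where
  "fold_head w = (case w of [] \<Rightarrow> [] | b # u \<Rightarrow> b # twist b u)"

lemma fold_head_Cons [simp]: "fold_head (b # u) = b # twist b u"
  by (simp add: fold_head_def)

lemma length_fold_head [simp]: "length (fold_head w) = length w"
  by (cases w) (simp_all add: fold_head_def)

lemma twist_twist [simp]: "twist b (twist b w) = w"
  by (auto simp: twist_def intro: nth_equalityI)

lemma fold_head_fold_head [simp]: "fold_head (fold_head w) = w"
  by (cases w) (simp_all add: fold_head_def)

lemma card_diff_coords_twist:
  assumes "length u = length v"
  shows "card (diff_coords (twist s u) (twist t v)) =
    (if s = t then card (diff_coords u v) else length u - card (diff_coords u v))"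
proof -
  have "diff_coords (twist s u) (twist t v) = (if s = t then diff_coords u v else {..<length u} - diff_coords u v)"
    using assms by (auto simp: diff_coords_def twist_def)
  then show ?thesis by (simp add: card_compl_diff_coords)
qed

text \<open>Across the first direction equal tails are twisted differently, so all coordinates
  differ. In every other direction both tails get the same twist and still differ in one
  place.\<close>

lemma fold_head_embedding:
  "restrict fold_head (cube_verts n) \<in> embeddings (hypercube n) (folded_hypercube n)"
proof -
  have "inj_on fold_head (cube_verts n)" by (metis fold_head_fold_head inj_onI)
  moreover have "adj (folded_hypercube n) (fold_head u) (fold_head v)" if uv: "adj (hypercube n) u v" for u v
  proof -
    have len: "length u = n" "length v = n" and d: "card (diff_coords u v) = 1"
      using uv by (auto simp: hypercube_def mem_cube_verts)
    then have "u \<noteq> v" using card_diff_coords_eq_0[of u v] by auto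
    then have "fold_head u \<noteq> fold_head v" by (metis fold_head_fold_head)
    moreover obtain a u' b v' where "u = a # u'" "v = b # v'"
      using \<open>u \<noteq> v\<close> len by (cases u; cases v) auto
    ultimately show ?thesis
      using len d by (auto simp: adj_folded_hypercube card_diff_coords_Cons card_diff_coords_twist split: if_splits)
  qed
  ultimately show ?thesis
    by (auto simp: embeddings_def mem_cube_verts inj_on_restrict_eq hypercube_def)
qed

text \<open>The inclusion covers the cube edges and \<open>fold_head\<close> the antipodal ones;
  being an involution, \<open>fold_head\<close> also supplies the preimages.\<close>

lemma folded_hypercube_covered: "edges_covered n (folded_hypercube n)"
  unfolding edges_covered_def
proof (intro allI impI)
  fix u v assume uv: "adj (folded_hypercube n) u v"
  then have mem: "u \<in> cube_verts n" "v \<in> cube_verts n"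
    using simple_graph_folded_hypercube[of n] by (auto simp: simple_graph_def)
  then have len: "length u = n" "length v = n" by (auto simp: mem_cube_verts)
  show "\<exists>\<psi>\<in>embeddings (hypercube n) (folded_hypercube n).
      \<exists>x y. adj (hypercube n) x y \<and> \<psi> x = u \<and> \<psi> y = v"
  proof (cases "card (diff_coords u v) = 1")
    case True
    then have "adj (hypercube n) u v" using mem by (simp add: hypercube_def)
    then show ?thesis using restrict_id_embedding mem by (metis id_apply restrict_apply')
  next
    case False
    then have d: "card (diff_coords u v) = n" "u \<noteq> v" using uv len by (auto simp: adj_folded_hypercube)
    then obtain a u' b v' where Cons: "u = a # u'" "v = b # v'"
      using len by (cases u; cases v) auto
    have "a \<noteq> b" "card (diff_coords u' v') = length u'"
      using d len card_diff_coords_le[of u' v'] unfolding Cons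
      by (auto simp: card_diff_coords_Cons split: if_splits)
    then have "card (diff_coords (fold_head u) (fold_head v)) = 1"
      using len unfolding Cons by (simp add: card_diff_coords_Cons card_diff_coords_twist)
    then have "adj (hypercube n) (fold_head u) (fold_head v)"
      using len by (simp add: hypercube_def mem_cube_verts)
    moreover have "restrict fold_head (cube_verts n) (fold_head w) = w" if "w \<in> cube_verts n" for w
      using that by (simp add: mem_cube_verts)
    ultimately show ?thesis using fold_head_embedding mem by blast
  qed
qed

text \<open>\<open>Q_(m+1)\<close> is the product of \<open>K2\<close> and \<open>Q_m\<close>; the
  map is the identity on the first factor and \<open>\<psi>\<close> on the second.\<close>

lemma hier_embedding:
  assumes "\<psi> \<in> embeddings (hypercube m) (folded_hypercube m)"
  shows "restrict (\<lambda>w. (hd w, \<psi> (tl w))) (cube_verts (Suc m))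
    \<in> embeddings (hypercube (Suc m)) (hier_folded_hypercube (Suc m))"
proof -
  have \<psi>: "\<psi> \<in> cube_verts m \<rightarrow>\<^sub>E cube_verts m" "inj_on \<psi> (cube_verts m)"
    "\<And>u v. adj (hypercube m) u v \<Longrightarrow> adj (folded_hypercube m) (\<psi> u) (\<psi> v)"
    using assms by (auto simp: embeddings_def)
  have len: "length (\<psi> u) = m" if "length u = m" for u
    using \<psi>(1) that by (auto simp: mem_cube_verts PiE_def Pi_def)
  have inj: "u = v" if "\<psi> u = \<psi> v" "length u = m" "length v = m" for u v
    using \<psi>(2) that by (auto simp: inj_on_def mem_cube_verts)
  have "adj (hier_folded_hypercube (Suc m)) (hd u, \<psi> (tl u)) (hd v, \<psi> (tl v))"
    if uv: "adj (hypercube (Suc m)) u v" for u v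
  proof -
    from uv obtain a u' b v' where Cons: "u = a # u'" "v = b # v'" "length u' = m" "length v' = m"
      by (auto simp: hypercube_def mem_cube_verts length_Suc_conv)
    moreover from uv have "card (diff_coords u v) = 1" by (simp add: hypercube_def)
    ultimately show ?thesis
      using \<psi>(3)[of u' v'] len[of u'] card_diff_coords_eq_0[of u' v']
      by (auto simp: adj_hier_folded_hypercube card_diff_coords_Cons hypercube_def mem_cube_verts
          simp del: card_eq_0_iff split: if_splits)
  qed
  moreover have "inj_on (\<lambda>w. (hd w, \<psi> (tl w))) (cube_verts (Suc m))"
  proof (rule inj_onI)
    fix u v assume "u \<in> cube_verts (Suc m)" "v \<in> cube_verts (Suc m)"
      and eq: "(hd u, \<psi> (tl u)) = (hd v, \<psi> (tl v))"
    then obtain a u' b v' where Cons: "u = a # u'" "v = b # v'" "length u' = m" "length v' = m"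
      by (auto simp: mem_cube_verts length_Suc_conv)
    with eq inj[of u' v'] show "u = v" by simp
  qed
  moreover have "u \<in> cube_verts (Suc m) \<and> v \<in> cube_verts (Suc m)"
    if "adj (hypercube (Suc m)) u v" for u v
    using that by (simp add: hypercube_def)
  moreover have "\<psi> (tl w) \<in> cube_verts m" if "w \<in> cube_verts (Suc m)" for w
    using that len[of "tl w"] by (simp add: mem_cube_verts)
  ultimately show ?thesis
    by (simp add: embeddings_def inj_on_restrict_eq)
qed

lemma hier_folded_hypercube_covered: "edges_covered (Suc m) (hier_folded_hypercube (Suc m))"
  unfolding edges_covered_def
proof (intro allI impI)
  fix p q assume pq: "adj (hier_folded_hypercube (Suc m)) p q"
  obtain a u b v where ab: "p = (a, u)" "q = (b, v)" by fastforce
  have "\<exists>\<psi>\<in>embeddings (hypercube m) (folded_hypercube m).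
      \<exists>x y. adj (hypercube (Suc m)) (a # x) (b # y) \<and> \<psi> x = u \<and> \<psi> y = v"
  proof (cases "a = b")
    case True
    then have "adj (folded_hypercube m) u v" using pq ab by (simp add: adj_hier_folded_hypercube)
    then obtain \<psi> x y where "\<psi>\<in>embeddings (hypercube m) (folded_hypercube m)"
      "adj (hypercube m) x y" "\<psi> x = u" "\<psi> y = v"
      using folded_hypercube_covered unfolding edges_covered_def by blast
    moreover from this have "adj (hypercube (Suc m)) (a # x) (b # y)"
      using True by (simp add: hypercube_def mem_cube_verts card_diff_coords_Cons)
    ultimately show ?thesis by blast
  next
    case False
    then have "u = v" "length u = m" using pq ab by (auto simp: adj_hier_folded_hypercube)
    moreover from this have "adj (hypercube (Suc m)) (a # u) (b # v)"
      using False card_diff_coords_eq_0[of u v]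
      by (simp add: hypercube_def mem_cube_verts card_diff_coords_Cons)
    ultimately show ?thesis
      using restrict_id_embedding[of m] by (metis id_apply mem_cube_verts restrict_apply')
  qed
  then obtain \<psi> x y where \<psi>: "\<psi>\<in>embeddings (hypercube m) (folded_hypercube m)"
    and xy: "adj (hypercube (Suc m)) (a # x) (b # y)" "\<psi> x = u" "\<psi> y = v" by blast
  have "a # x \<in> cube_verts (Suc m)" "b # y \<in> cube_verts (Suc m)"
    using xy(1) by (auto simp: hypercube_def)
  then have "restrict (\<lambda>w. (hd w, \<psi> (tl w))) (cube_verts (Suc m)) (a # x) = p"
    "restrict (\<lambda>w. (hd w, \<psi> (tl w))) (cube_verts (Suc m)) (b # y) = q"
    using xy ab by simp_all
  with xy(1) hier_embedding[OF \<psi>] show "\<exists>\<psi>\<in>embeddings (hypercube (Suc m)) (hier_folded_hypercube (Suc m)).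
      \<exists>x y. adj (hypercube (Suc m)) x y \<and> \<psi> x = p \<and> \<psi> y = q"
    by blast
qed

section \<open>Specialization to both parities\<close>

lemma labelled_graph_folded_hypercube:
  assumes "even n"
  shows "\<exists>A0. labelled_graph n (folded_hypercube n) A0"
  using assms folded_hypercube_label_iso folded_hypercube_covered simple_graph_folded_hypercube
  by (blast intro: labelled_graph.intro)

lemma labelled_graph_hier_folded_hypercube:
  assumes "odd n"
  shows "\<exists>A0. labelled_graph n (hier_folded_hypercube n) A0"
proof -
  \<comment> \<open>An odd \<open>n\<close> is a successor, so the subtraction in
    \<open>hier_folded_hypercube\<close> does not truncate.\<close>
  from assms obtain m where "n = Suc m" "even m" by (cases n) auto
  then show ?thesis
    using hier_folded_hypercube_label_iso hier_folded_hypercube_covered simple_graph_hier_folded_hypercube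
    by (blast intro: labelled_graph.intro)
qed

theorem theorem3:
  fixes n :: nat
  shows
    "((even n \<longrightarrow>
         magic_faced n (folded_hypercube n) \<noteq> {} \<and>
         (\<forall>A \<in> magic_faced n (folded_hypercube n). \<forall>B \<in> magic_faced n (folded_hypercube n).
            \<exists>\<sigma> \<in> automorphisms (folded_hypercube n).
              B = compose (verts (folded_hypercube n)) A \<sigma>)) \<and>
      (odd n \<longrightarrow>
         magic_faced n (hier_folded_hypercube n) \<noteq> {} \<and>
         (\<forall>A \<in> magic_faced n (hier_folded_hypercube n). \<forall>B \<in> magic_faced n (hier_folded_hypercube n).
            \<exists>\<sigma> \<in> automorphisms (hier_folded_hypercube n).
              B = compose (verts (hier_folded_hypercube n)) A \<sigma>))) \<and>
     ((even n \<longrightarrow>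
         (\<forall>A \<in> magic_faced n (folded_hypercube n).
            bij_betw (\<lambda>\<phi>. compose (verts (hypercube n)) A \<phi>)
              (embeddings (hypercube n) (folded_hypercube n))
              (magic_faced n (hypercube n)))) \<and>
      (odd n \<longrightarrow>
         (\<forall>A \<in> magic_faced n (hier_folded_hypercube n).
            bij_betw (\<lambda>\<phi>. compose (verts (hypercube n)) A \<phi>)
              (embeddings (hypercube n) (hier_folded_hypercube n))
              (magic_faced n (hypercube n)))))"
  by (intro conjI impI ballI;
      (drule labelled_graph_folded_hypercube | drule labelled_graph_hier_folded_hypercube);
      erule exE;
      (rule labelled_graph.magic_nonempty labelled_graph.magic_unique labelled_graph.magic_bij_embeddings);
      assumption)

end
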